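(* There exists a unital C*-algebra $A$ which is infinite, and which contains a dense, unital $*$-subalgebra $A_0$ (i.e. $A_0$ contains the unit of $A$ and is norm-dense in $A$) that is stably finite.
   Context: A unital algebra $B$ is finite if every left invertible element of $B$ is right invertible (i.e. $xy=1$ implies $yx=1$ for $x,y\in B$), and infinite otherwise. A unital algebra $B$ is stably finite if the matrix algebra $M_n(B)$ is finite for every $n\in\mathbb{N}$. *)

theory Defs
  imports Complex_Main
begin

record 'a cstar =
  c_carrier :: "'a set"
  c_zero :: 'a
  c_one :: 'a
  c_add :: "'a \<Rightarrow> 'a \<Rightarrow> 'a"
  c_smult :: "complex \<Rightarrow> 'a \<Rightarrow> 'a"
  c_mult :: "'a \<Rightarrow> 'a \<Rightarrow> 'a"
  c_star :: "'a \<Rightarrow> 'a"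
  c_norm :: "'a \<Rightarrow> real"

definition c_dist :: "'a cstar \<Rightarrow> 'a \<Rightarrow> 'a \<Rightarrow> real" where
  "c_dist A x y = c_norm A (c_add A x (c_smult A (-1) y))"

definition unital_cstar_algebra :: "'a cstar \<Rightarrow> bool" where
  "unital_cstar_algebra A \<longleftrightarrow>
    (let C = c_carrier A; add = c_add A; sm = c_smult A; mult = c_mult A;
         st = c_star A; nm = c_norm A; z = c_zero A; u = c_one A in
     \<comment> \<open>closure\<close>
     z \<in> C \<and> u \<in> C \<and>
     (\<forall>x\<in>C. \<forall>y\<in>C. add x y \<in> C \<and> mult x y \<in> C) \<and>
     (\<forall>c. \<forall>x\<in>C. sm c x \<in> C) \<and> (\<forall>x\<in>C. st x \<in> C) \<and>
     \<comment> \<open>complex vector space\<close>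
     (\<forall>x\<in>C. \<forall>y\<in>C. \<forall>w\<in>C. add (add x y) w = add x (add y w)) \<and>
     (\<forall>x\<in>C. \<forall>y\<in>C. add x y = add y x) \<and>
     (\<forall>x\<in>C. add z x = x) \<and>
     (\<forall>x\<in>C. \<exists>y\<in>C. add x y = z) \<and>
     (\<forall>c. \<forall>x\<in>C. \<forall>y\<in>C. sm c (add x y) = add (sm c x) (sm c y)) \<and>
     (\<forall>c d. \<forall>x\<in>C. sm (c + d) x = add (sm c x) (sm d x)) \<and>
     (\<forall>c d. \<forall>x\<in>C. sm (c * d) x = sm c (sm d x)) \<and>
     (\<forall>x\<in>C. sm 1 x = x) \<and>
     \<comment> \<open>associative unital algebra\<close>
     (\<forall>x\<in>C. \<forall>y\<in>C. \<forall>w\<in>C. mult (mult x y) w = mult x (mult y w)) \<and>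
     (\<forall>x\<in>C. mult u x = x \<and> mult x u = x) \<and>
     (\<forall>x\<in>C. \<forall>y\<in>C. \<forall>w\<in>C. mult x (add y w) = add (mult x y) (mult x w)
                         \<and> mult (add x y) w = add (mult x w) (mult y w)) \<and>
     (\<forall>c. \<forall>x\<in>C. \<forall>y\<in>C. sm c (mult x y) = mult (sm c x) y \<and> sm c (mult x y) = mult x (sm c y)) \<and>
     \<comment> \<open>involution\<close>
     (\<forall>x\<in>C. st (st x) = x) \<and>
     (\<forall>x\<in>C. \<forall>y\<in>C. st (add x y) = add (st x) (st y)) \<and>
     (\<forall>c. \<forall>x\<in>C. st (sm c x) = sm (cnj c) (st x)) \<and>
     (\<forall>x\<in>C. \<forall>y\<in>C. st (mult x y) = mult (st y) (st x)) \<and>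
     \<comment> \<open>submultiplicative norm\<close>
     (\<forall>x\<in>C. nm x \<ge> 0 \<and> (nm x = 0 \<longleftrightarrow> x = z)) \<and>
     (\<forall>x\<in>C. \<forall>y\<in>C. nm (add x y) \<le> nm x + nm y) \<and>
     (\<forall>c. \<forall>x\<in>C. nm (sm c x) = cmod c * nm x) \<and>
     (\<forall>x\<in>C. \<forall>y\<in>C. nm (mult x y) \<le> nm x * nm y) \<and>
     \<comment> \<open>completeness\<close>
     (\<forall>f. (\<forall>n. f n \<in> C) \<longrightarrow>
          (\<forall>e>0. \<exists>N. \<forall>m\<ge>N. \<forall>n\<ge>N. c_dist A (f m) (f n) < e) \<longrightarrow>
          (\<exists>x\<in>C. (\<lambda>n. c_dist A (f n) x) \<longlonglongrightarrow> 0)) \<and>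
     \<comment> \<open>C*-identity\<close>
     (\<forall>x\<in>C. nm (mult (st x) x) = (nm x)\<^sup>2))"

definition unital_star_subalgebra :: "'a cstar \<Rightarrow> 'a set \<Rightarrow> bool" where
  "unital_star_subalgebra A S \<longleftrightarrow>
     S \<subseteq> c_carrier A \<and> c_zero A \<in> S \<and> c_one A \<in> S \<and>
     (\<forall>x\<in>S. \<forall>y\<in>S. c_add A x y \<in> S \<and> c_mult A x y \<in> S) \<and>
     (\<forall>c. \<forall>x\<in>S. c_smult A c x \<in> S) \<and> (\<forall>x\<in>S. c_star A x \<in> S)"

definition norm_dense :: "'a cstar \<Rightarrow> 'a set \<Rightarrow> bool" where
  "norm_dense A S \<longleftrightarrow> (\<forall>x\<in>c_carrier A. \<forall>e>0. \<exists>y\<in>S. c_dist A x y < e)"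

definition alg_finite :: "'a set \<Rightarrow> ('a \<Rightarrow> 'a \<Rightarrow> 'a) \<Rightarrow> 'a \<Rightarrow> bool" where
  "alg_finite S mult u \<longleftrightarrow> (\<forall>x\<in>S. \<forall>y\<in>S. mult x y = u \<longrightarrow> mult y x = u)"

fun asum :: "('a \<Rightarrow> 'a \<Rightarrow> 'a) \<Rightarrow> 'a \<Rightarrow> (nat \<Rightarrow> 'a) \<Rightarrow> nat \<Rightarrow> 'a" where
  "asum add z f 0 = z"
| "asum add z f (Suc n) = add (asum add z f n) (f n)"

definition mats :: "nat \<Rightarrow> 'a set \<Rightarrow> (nat \<Rightarrow> nat \<Rightarrow> 'a) set" where
  "mats n S = {X. (\<forall>i<n. \<forall>j<n. X i j \<in> S) \<and> (\<forall>i j. (i \<ge> n \<or> j \<ge> n) \<longrightarrow> X i j = undefined)}"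

definition mat_mult :: "('a \<Rightarrow> 'a \<Rightarrow> 'a) \<Rightarrow> 'a \<Rightarrow> ('a \<Rightarrow> 'a \<Rightarrow> 'a) \<Rightarrow> nat
    \<Rightarrow> (nat \<Rightarrow> nat \<Rightarrow> 'a) \<Rightarrow> (nat \<Rightarrow> nat \<Rightarrow> 'a) \<Rightarrow> (nat \<Rightarrow> nat \<Rightarrow> 'a)" where
  "mat_mult add z mult n X Y =
     (\<lambda>i j. if i < n \<and> j < n then asum add z (\<lambda>k. mult (X i k) (Y k j)) n else undefined)"

definition mat_one :: "'a \<Rightarrow> 'a \<Rightarrow> nat \<Rightarrow> (nat \<Rightarrow> nat \<Rightarrow> 'a)" where
  "mat_one z u n = (\<lambda>i j. if i < n \<and> j < n then (if i = j then u else z) else undefined)"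

definition stably_finite :: "'a cstar \<Rightarrow> 'a set \<Rightarrow> bool" where
  "stably_finite A S \<longleftrightarrow>
    (\<forall>n\<ge>1. alg_finite (mats n S) (mat_mult (c_add A) (c_zero A) (c_mult A) n)
                      (mat_one (c_zero A) (c_one A) n))"

end

theory Submission
  imports Defs "HOL-Analysis.Bounded_Linear_Function" "Jordan_Normal_Form.Determinant"
    "HOL-Computational_Algebra.Formal_Laurent_Series"
begin

text \<open>
  Let \<open>T\<close> be the weighted shift \<open>T e\<^sub>n = (1 - 2\<^bsup>-(n+1)\<^esup>) e\<^sub>n\<^sub>+\<^sub>1\<close> on the
  Hilbert space of square-summable sequences, \<open>A\<^sub>0\<close> the unital *-algebra generated by \<open>T\<close> and \<open>A\<close> its
  norm closure. Since \<open>1 - T\<^sup>*T\<close> has norm less than 1, \<open>T\<^sup>*T\<close> is invertible in \<open>A\<close>, so \<open>T\<close> is left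
  invertible in \<open>A\<close>; it is not right invertible, and \<open>A\<close> is infinite (it is the Toeplitz algebra).

  Every \<open>a\<close> in \<open>A\<^sub>0\<close> is banded and, for each \<open>k\<close>, the matrix entry at \<open>(n, n + k)\<close> is a polynomial
  \<open>p\<^sub>k\<close> evaluated at \<open>t = 2\<^bsup>-n\<^esup>\<close>; as these points accumulate at 0, the polynomials are determined by
  \<open>a\<close>. This embeds \<open>A\<^sub>0\<close> into a ring of skew Laurent polynomials with coefficients in \<open>\<complex>[t]\<close>, in
  which \<open>t\<close> generates an ideal with commutative quotient. If \<open>XY = 1\<close> for matrices over \<open>A\<^sub>0\<close>, then
  \<open>YX = 1\<close> modulo \<open>t\<close>, because square matrices over a commutative domain have this property. Hence
  the idempotent \<open>Q = 1 - YX\<close> is divisible by \<open>t\<close>, so \<open>Q = Q\<^sup>s\<close> is divisible by every power of \<open>t\<close>,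
  and \<open>Q = 0\<close>.
\<close>

subsection \<open>Square-summable sequences\<close>

typedef ell2 = "{x :: nat \<Rightarrow> complex. summable (\<lambda>n. (cmod (x n))\<^sup>2)}"
  morphisms coord Abs_ell2
  by (rule exI[of _ "\<lambda>_. 0"]) simp

setup_lifting type_definition_ell2

lemma summable_coord: "summable (\<lambda>n. (cmod (coord x n))\<^sup>2)"
  using coord[of x] by simp

lemma ell2_eqI: "(\<And>n. coord x n = coord y n) \<Longrightarrow> x = y"
  by (metis coord_inject ext)

lemma norm_add_sq_le: "(norm (a + b :: 'a :: real_normed_vector))\<^sup>2 \<le> 2 * (norm a)\<^sup>2 + 2 * (norm b)\<^sup>2"
proof -
  have "(norm (a + b))\<^sup>2 \<le> (norm a + norm b)\<^sup>2"
    by (simp add: norm_triangle_ineq power_mono)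
  also have "\<dots> \<le> 2 * (norm a)\<^sup>2 + 2 * (norm b)\<^sup>2"
    using zero_le_power2[of "norm a - norm b"] by (simp add: power2_eq_square algebra_simps)
  finally show ?thesis .
qed

lemma summable_norm_sq_add:
  fixes f g :: "nat \<Rightarrow> 'a :: real_normed_vector"
  assumes "summable (\<lambda>n. (norm (f n))\<^sup>2)" "summable (\<lambda>n. (norm (g n))\<^sup>2)"
  shows "summable (\<lambda>n. (norm (f n + g n))\<^sup>2)"
proof (rule summable_comparison_test')
  show "summable (\<lambda>n. 2 * (norm (f n))\<^sup>2 + 2 * (norm (g n))\<^sup>2)"
    using assms by (intro summable_add summable_mult)
qed (use norm_add_sq_le in simp)

lemma summable_norm_sq_mult:
  fixes f d :: "nat \<Rightarrow> complex"
  assumes "summable (\<lambda>n. (norm (f n))\<^sup>2)" "\<And>n. norm (d n) \<le> C"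
  shows "summable (\<lambda>n. (norm (d n * f n))\<^sup>2)"
proof (rule summable_comparison_test')
  show "summable (\<lambda>n. C\<^sup>2 * (norm (f n))\<^sup>2)"
    using assms(1) by (rule summable_mult)
  show "norm ((norm (d n * f n))\<^sup>2) \<le> C\<^sup>2 * (norm (f n))\<^sup>2" for n
    using assms(2)[of n] by (auto simp: norm_mult power_mult_distrib intro!: mult_right_mono power_mono)
qed

lemma summable_inner:
  fixes f g :: "nat \<Rightarrow> 'a :: real_inner"
  assumes "summable (\<lambda>n. (norm (f n))\<^sup>2)" "summable (\<lambda>n. (norm (g n))\<^sup>2)"
  shows "summable (\<lambda>n. inner (f n) (g n))"
proof (rule summable_comparison_test')
  show "summable (\<lambda>n. (norm (f n))\<^sup>2 + (norm (g n))\<^sup>2)"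
    using assms by (intro summable_add)
  fix n
  have "norm (inner (f n) (g n)) \<le> norm (f n) * norm (g n)"
    by (simp add: Cauchy_Schwarz_ineq2)
  also have "\<dots> \<le> (norm (f n))\<^sup>2 + (norm (g n))\<^sup>2"
    using sum_squares_bound[of "norm (f n)" "norm (g n)"]
      mult_nonneg_nonneg[OF norm_ge_zero[of "f n"] norm_ge_zero[of "g n"]] by linarith
  finally show "norm (inner (f n) (g n)) \<le> (norm (f n))\<^sup>2 + (norm (g n))\<^sup>2" .
qed

section \<open>Inner product, norm and completeness of \<open>ell2\<close>\<close>

instantiation ell2 :: real_inner
begin

lift_definition zero_ell2 :: ell2 is "\<lambda>_. 0" by simp

lift_definition plus_ell2 :: "ell2 \<Rightarrow> ell2 \<Rightarrow> ell2" is "\<lambda>x y n. x n + y n"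
  by (rule summable_norm_sq_add)

lift_definition uminus_ell2 :: "ell2 \<Rightarrow> ell2" is "\<lambda>x n. - x n"
  by simp

lift_definition minus_ell2 :: "ell2 \<Rightarrow> ell2 \<Rightarrow> ell2" is "\<lambda>x y n. x n - y n"
  using summable_norm_sq_add[where g = "\<lambda>n. - _ n"] by auto

lift_definition scaleR_ell2 :: "real \<Rightarrow> ell2 \<Rightarrow> ell2" is "\<lambda>r x n. r *\<^sub>R x n"
  by (simp add: power_mult_distrib summable_mult)

text \<open>On \<open>complex\<close>, \<open>inner\<close> is the real part of
  \<open>z * cnj w\<close>; this is therefore the real part of the usual Hermitian product, and it
  induces the same norm.\<close>

definition inner_ell2 :: "ell2 \<Rightarrow> ell2 \<Rightarrow> real" where
  "inner_ell2 x y = (\<Sum>n. inner (coord x n) (coord y n))"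

definition norm_ell2 :: "ell2 \<Rightarrow> real" where
  "norm_ell2 x = sqrt (inner x x)"

definition dist_ell2 :: "ell2 \<Rightarrow> ell2 \<Rightarrow> real" where
  "dist_ell2 x y = norm (x - y)"

definition sgn_ell2 :: "ell2 \<Rightarrow> ell2" where
  "sgn_ell2 x = scaleR (inverse (norm x)) x"

definition uniformity_ell2 :: "(ell2 \<times> ell2) filter" where
  "uniformity_ell2 = (INF e\<in>{0<..}. principal {(x, y). dist x y < e})"

definition open_ell2 :: "ell2 set \<Rightarrow> bool" where
  "open_ell2 U = (\<forall>x\<in>U. eventually (\<lambda>(x', y). x' = x \<longrightarrow> y \<in> U) uniformity)"

instance
proof
  fix x y z :: ell2 and a b :: real and U :: "ell2 set"
  note si = summable_inner[OF summable_coord summable_coord]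
  show "x + y + z = x + (y + z)" by transfer (simp add: add.assoc)
  show "x + y = y + x" by transfer (simp add: add.commute)
  show "0 + x = x" by transfer simp
  show "- x + x = 0" by transfer simp
  show "x - y = x + - y" by transfer simp
  show "a *\<^sub>R (x + y) = a *\<^sub>R x + a *\<^sub>R y" by transfer (simp add: scaleR_add_right)
  show "(a + b) *\<^sub>R x = a *\<^sub>R x + b *\<^sub>R x" by transfer (simp add: scaleR_add_left)
  show "a *\<^sub>R b *\<^sub>R x = (a * b) *\<^sub>R x" by transfer simp
  show "1 *\<^sub>R x = x" by transfer simp
  show "dist x y = norm (x - y)" by (rule dist_ell2_def)
  show "sgn x = inverse (norm x) *\<^sub>R x" by (rule sgn_ell2_def)
  show "uniformity = (INF e\<in>{0<..}. principal {(x, y :: ell2). dist x y < e})"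
    by (rule uniformity_ell2_def)
  show "open U = (\<forall>x\<in>U. eventually (\<lambda>(x', y). x' = x \<longrightarrow> y \<in> U) uniformity)"
    by (rule open_ell2_def)
  show "inner x y = inner y x" by (simp add: inner_ell2_def inner_commute)
  show "inner (x + y) z = inner x z + inner y z"
    by (simp add: inner_ell2_def plus_ell2.rep_eq inner_add_left suminf_add si)
  show "inner (a *\<^sub>R x) y = a * inner x y"
    by (simp add: inner_ell2_def scaleR_ell2.rep_eq suminf_mult si)
  show "0 \<le> inner x x"
    unfolding inner_ell2_def by (rule suminf_nonneg[OF si]) simp
  show "inner x x = 0 \<longleftrightarrow> x = 0"
    unfolding inner_ell2_def using suminf_eq_zero_iff[OF si[of x x]]
    by (auto simp: zero_ell2.rep_eq intro: ell2_eqI)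
  show "norm x = sqrt (inner x x)" by (rule norm_ell2_def)
qed

end

lemma norm_ell2_sq: "(norm (x :: ell2))\<^sup>2 = (\<Sum>n. (cmod (coord x n))\<^sup>2)"
  by (simp add: power2_norm_eq_inner[of x] inner_ell2_def dot_square_norm)

lemma sum_coord_le_norm_sq: "(\<Sum>n<N. (cmod (coord x n))\<^sup>2) \<le> (norm x)\<^sup>2"
  unfolding norm_ell2_sq by (rule sum_le_suminf[OF summable_coord]) auto

lemma coord_le_norm: "cmod (coord x n) \<le> norm x"
proof -
  have "(cmod (coord x n))\<^sup>2 \<le> (\<Sum>i<Suc n. (cmod (coord x i))\<^sup>2)"
    by (rule member_le_sum) auto
  also note sum_coord_le_norm_sq
  finally show ?thesis by (rule power2_le_imp_le) simp
qed

lemma norm_ell2_le: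
  assumes "\<And>N. (\<Sum>n<N. (cmod (coord x n))\<^sup>2) \<le> C\<^sup>2" "0 \<le> C"
  shows "norm x \<le> C"
proof (rule power2_le_imp_le)
  show "(norm x)\<^sup>2 \<le> C\<^sup>2"
    unfolding norm_ell2_sq by (rule suminf_le_const[OF summable_coord assms(1)])
qed fact

lemma norm_ell2_le_mult:
  assumes "\<And>n. cmod (coord y n) \<le> C * cmod (coord x n)" "0 \<le> C"
  shows "norm y \<le> C * norm x"
proof (rule norm_ell2_le)
  fix N
  have "(\<Sum>n<N. (cmod (coord y n))\<^sup>2) \<le> (\<Sum>n<N. C\<^sup>2 * (cmod (coord x n))\<^sup>2)"
    unfolding power_mult_distrib[symmetric] by (intro sum_mono power_mono assms(1)) simp
  also have "\<dots> \<le> C\<^sup>2 * (norm x)\<^sup>2"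
    unfolding sum_distrib_left[symmetric] by (intro mult_left_mono sum_coord_le_norm_sq) simp
  finally show "(\<Sum>n<N. (cmod (coord y n))\<^sup>2) \<le> (C * norm x)\<^sup>2"
    unfolding power_mult_distrib .
qed (intro mult_nonneg_nonneg assms norm_ge_zero)

instance ell2 :: banach
proof
  fix X :: "nat \<Rightarrow> ell2"
  assume X: "Cauchy X"
  have "Cauchy (\<lambda>k. coord (X k) n)" for n
  proof (rule CauchyI)
    fix e :: real assume "e > 0"
    then obtain M where M: "\<And>k l. k \<ge> M \<Longrightarrow> l \<ge> M \<Longrightarrow> norm (X k - X l) < e"
      using CauchyD[OF X \<open>e > 0\<close>] by blast
    have "norm (coord (X k) n - coord (X l) n) < e" if "k \<ge> M" "l \<ge> M" for k l
      using coord_le_norm[of "X k - X l" n] M[OF that] by (simp add: minus_ell2.rep_eq)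
    then show "\<exists>M. \<forall>m\<ge>M. \<forall>l\<ge>M. norm (coord (X m) n - coord (X l) n) < e" by blast
  qed
  then have "\<forall>n. \<exists>c. (\<lambda>k. coord (X k) n) \<longlonglongrightarrow> c"
    by (simp add: Cauchy_convergent_iff convergent_def)
  then obtain y where y: "\<And>n. (\<lambda>k. coord (X k) n) \<longlonglongrightarrow> y n" by metis
  \<comment> \<open>The Cauchy bound on a finite partial sum survives the limit in the second index.
    As the result is uniform in N, it serves twice: with e = 1 it shows that y is square-summable,
    with e/2 it gives convergence in norm.\<close>
  have tail: "\<exists>M. \<forall>k\<ge>M. \<forall>N. (\<Sum>n<N. (cmod (coord (X k) n - y n))\<^sup>2) \<le> e\<^sup>2" if e: "e > 0" for e :: real
  proof -
    obtain M where M: "\<And>k l. k \<ge> M \<Longrightarrow> l \<ge> M \<Longrightarrow> norm (X k - X l) < e"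
      using CauchyD[OF X e] by blast
    have "(\<Sum>n<N. (cmod (coord (X k) n - y n))\<^sup>2) \<le> e\<^sup>2" if "k \<ge> M" for k N
    proof (rule tendsto_upperbound)
      show "(\<lambda>l. \<Sum>n<N. (cmod (coord (X k) n - coord (X l) n))\<^sup>2) \<longlonglongrightarrow>
            (\<Sum>n<N. (cmod (coord (X k) n - y n))\<^sup>2)"
        by (intro tendsto_intros y)
      have "(\<Sum>n<N. (cmod (coord (X k) n - coord (X l) n))\<^sup>2) \<le> e\<^sup>2" if "l \<ge> M" for l
      proof -
        have "(\<Sum>n<N. (cmod (coord (X k) n - coord (X l) n))\<^sup>2) \<le> (norm (X k - X l))\<^sup>2"
          using sum_coord_le_norm_sq[of "X k - X l" N] by (simp add: minus_ell2.rep_eq)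
        also have "\<dots> \<le> e\<^sup>2"
          using M[OF \<open>k \<ge> M\<close> that] by (intro power_mono) auto
        finally show ?thesis .
      qed
      then show "\<forall>\<^sub>F l in sequentially. (\<Sum>n<N. (cmod (coord (X k) n - coord (X l) n))\<^sup>2) \<le> e\<^sup>2"
        by (auto simp: eventually_sequentially)
    qed simp
    then show ?thesis by blast
  qed
  obtain M where "\<And>N. (\<Sum>n<N. (cmod (coord (X M) n - y n))\<^sup>2) \<le> 1\<^sup>2"
    using tail[of 1] by auto
  then have "summable (\<lambda>n. (cmod (coord (X M) n - y n))\<^sup>2)"
    by (intro bounded_imp_summable[where B = "1\<^sup>2"]) (auto simp: lessThan_Suc_atMost[symmetric] simp del: sum.lessThan_Suc)
  from summable_norm_sq_add[OF this[unfolded norm_minus_commute[of "coord _ _"]] summable_coord[of "X M"]]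
  have "summable (\<lambda>n. (cmod (y n))\<^sup>2)" by simp
  then have z: "coord (Abs_ell2 y) = y" by (simp add: Abs_ell2_inverse)
  have "X \<longlonglongrightarrow> Abs_ell2 y"
  proof (rule LIMSEQ_I)
    fix e :: real assume "e > 0"
    then obtain M where M: "\<And>k N. k \<ge> M \<Longrightarrow> (\<Sum>n<N. (cmod (coord (X k) n - y n))\<^sup>2) \<le> (e/2)\<^sup>2"
      using tail[of "e/2"] by auto
    have "norm (X k - Abs_ell2 y) < e" if "k \<ge> M" for k
      using norm_ell2_le[of "X k - Abs_ell2 y" "e/2"] M[OF that] \<open>e > 0\<close>
      by (simp add: minus_ell2.rep_eq z)
    then show "\<exists>M. \<forall>k\<ge>M. norm (X k - Abs_ell2 y) < e" by blast
  qed
  then show "convergent X" by (auto simp: convergent_def)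
qed

subsection \<open>Adjoints\<close>

text \<open>For complex-linear operators on \<open>ell2\<close> this condition on real parts already
  yields the Hermitian adjoint, since replacing x by i x recovers the imaginary parts.\<close>

definition is_adjoint :: "('a::real_inner \<Rightarrow>\<^sub>L 'a) \<Rightarrow> ('a \<Rightarrow>\<^sub>L 'a) \<Rightarrow> bool" where
  "is_adjoint a b \<longleftrightarrow> (\<forall>x y. inner (a x) y = inner x (b y))"

text \<open>Existence is proved for the operators at hand: by induction over the generated algebra,
  then for its closure by passing to limits.\<close>

definition adjoint_of :: "('a::real_inner \<Rightarrow>\<^sub>L 'a) \<Rightarrow> ('a \<Rightarrow>\<^sub>L 'a)" where
  "adjoint_of a = (THE b. is_adjoint a b)"

lemma is_adjoint_sym: "is_adjoint a b \<Longrightarrow> is_adjoint b a"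
  by (simp add: is_adjoint_def inner_commute)

lemma is_adjoint_unique:
  assumes "is_adjoint a b" "is_adjoint a c"
  shows "b = c"
proof (rule blinfun_eqI)
  fix y
  have "inner x (b y) = inner x (c y)" for x
    using assms by (simp add: is_adjoint_def)
  then show "b y = c y"
    using vector_eq_ldot by blast
qed

lemma adjoint_of_eq: "is_adjoint a b \<Longrightarrow> adjoint_of a = b"
  unfolding adjoint_of_def by (rule the_equality) (auto intro: is_adjoint_unique)

lemma is_adjoint_id: "is_adjoint id_blinfun id_blinfun"
  by (simp add: is_adjoint_def)

lemma is_adjoint_add: "is_adjoint a b \<Longrightarrow> is_adjoint c d \<Longrightarrow> is_adjoint (a + c) (b + d)"
  by (simp add: is_adjoint_def blinfun.add_left inner_add_left inner_add_right)

lemma is_adjoint_diff: "is_adjoint a b \<Longrightarrow> is_adjoint c d \<Longrightarrow> is_adjoint (a - c) (b - d)"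
  by (simp add: is_adjoint_def blinfun.diff_left inner_diff_left inner_diff_right)

lemma is_adjoint_compose:
  "is_adjoint a b \<Longrightarrow> is_adjoint c d \<Longrightarrow> is_adjoint (a o\<^sub>L c) (d o\<^sub>L b)"
  by (simp add: is_adjoint_def)

text \<open>Cauchy-Schwarz for |b y|^2 = <a (b y), y>, after which one factor |b y| cancels.\<close>

lemma norm_adjoint_le:
  assumes "is_adjoint a b"
  shows "norm b \<le> norm a"
proof (rule norm_blinfun_bound)
  fix y
  have "norm (b y) * norm (b y) = inner (a (b y)) y"
    using assms by (simp add: is_adjoint_def power2_norm_eq_inner[symmetric] power2_eq_square)
  also have "\<dots> \<le> norm (a (b y)) * norm y"
    by (rule norm_cauchy_schwarz)
  also have "\<dots> \<le> norm a * norm (b y) * norm y"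
    by (intro mult_right_mono norm_blinfun) simp
  finally have "norm (b y) * norm (b y) \<le> norm (b y) * (norm a * norm y)"
    by (simp add: mult_ac)
  then show "norm (b y) \<le> norm a * norm y"
    by (cases "norm (b y) = 0") (auto simp: mult_le_cancel_left)
qed simp

lemma norm_adjoint: "is_adjoint a b \<Longrightarrow> norm b = norm a"
  by (rule antisym[OF norm_adjoint_le norm_adjoint_le[OF is_adjoint_sym]])

text \<open>The C*-identity. The lower bound for the product comes from |a x|^2 = <x, (b a)
  x>.\<close>

lemma norm_adjoint_compose:
  assumes "is_adjoint a b"
  shows "norm (b o\<^sub>L a) = (norm a)\<^sup>2"
proof (rule antisym)
  show "norm (b o\<^sub>L a) \<le> (norm a)\<^sup>2"
    using norm_blinfun_compose[of b a] unfolding norm_adjoint[OF assms] power2_eq_square .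
  have "norm a \<le> sqrt (norm (b o\<^sub>L a))"
  proof (rule norm_blinfun_bound)
    fix x
    have "(norm (a x))\<^sup>2 = inner x ((b o\<^sub>L a) x)"
      using assms by (simp add: is_adjoint_def power2_norm_eq_inner)
    also have "\<dots> \<le> norm x * (norm (b o\<^sub>L a) * norm x)"
      by (intro order_trans[OF norm_cauchy_schwarz] mult_left_mono norm_blinfun) simp
    also have "\<dots> = (sqrt (norm (b o\<^sub>L a)) * norm x)\<^sup>2"
      by (simp add: power_mult_distrib power2_eq_square)
    finally show "norm (a x) \<le> sqrt (norm (b o\<^sub>L a)) * norm x"
      by (rule power2_le_imp_le) simp
  qed simp
  then have "(norm a)\<^sup>2 \<le> (sqrt (norm (b o\<^sub>L a)))\<^sup>2"
    by (intro power_mono) auto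
  then show "(norm a)\<^sup>2 \<le> norm (b o\<^sub>L a)" by simp
qed

text \<open>Taking adjoints is isometric, so the adjoints of a convergent sequence are Cauchy; the
  adjoint relation then passes to the limits pointwise.\<close>

lemma adjoint_limit:
  fixes a :: "nat \<Rightarrow> 'a :: {real_inner, banach} \<Rightarrow>\<^sub>L 'a"
  assumes adj: "\<And>n. is_adjoint (a n) (b n)" and lim: "a \<longlonglongrightarrow> l"
  shows "\<exists>m. b \<longlonglongrightarrow> m \<and> is_adjoint l m"
proof -
  have eq: "norm (b m - b n) = norm (a m - a n)" for m n
    using norm_adjoint[OF is_adjoint_diff[OF adj adj]] by simp
  have "Cauchy b"
    using LIMSEQ_imp_Cauchy[OF lim] unfolding Cauchy_iff eq .
  then obtain m where m: "b \<longlonglongrightarrow> m"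
    by (auto simp: Cauchy_convergent_iff convergent_def)
  have "inner (l x) y = inner x (m y)" for x y
  proof (rule LIMSEQ_unique)
    show "(\<lambda>n. inner (a n x) y) \<longlonglongrightarrow> inner (l x) y"
      by (intro tendsto_intros lim)
    show "(\<lambda>n. inner (a n x) y) \<longlonglongrightarrow> inner x (m y)"
      unfolding adj[unfolded is_adjoint_def, rule_format] by (intro tendsto_intros m)
  qed
  with m show ?thesis by (auto simp: is_adjoint_def)
qed

subsection \<open>The weighted shift and its *-algebra\<close>

lift_definition ebasis :: "nat \<Rightarrow> ell2" is "\<lambda>m n. if n = m then 1 else 0"
  by (rule summable_finite[of "{_}"]) auto

lift_definition cscale :: "complex \<Rightarrow> ell2 \<Rightarrow> ell2" is "\<lambda>c x n. c * x n"
  by (rule summable_norm_sq_mult) auto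

lemma norm_cscale_le: "norm (cscale c x) \<le> cmod c * norm x"
  by (rule norm_ell2_le_mult) (auto simp: cscale.rep_eq norm_mult)

text \<open>\<open>blinfun\<close> consists of real-linear maps and carries only real scalars.
  Complex scalars enter as operators, and scaling an operator by c is composition with
  \<open>cmult c\<close>.\<close>

lift_definition cmult :: "complex \<Rightarrow> ell2 \<Rightarrow>\<^sub>L ell2" is cscale
proof (rule bounded_linear_intro)
  fix c x y r
  show "cscale c (x + y) = cscale c x + cscale c y"
    by transfer (simp add: algebra_simps)
  show "cscale c (r *\<^sub>R x) = r *\<^sub>R cscale c x"
    by transfer simp
  show "norm (cscale c x) \<le> norm x * cmod c"
    using norm_cscale_le[of c x] by (simp add: mult.commute)
qed

lemma coord_cmult [simp]: "coord (cmult c x) n = c * coord x n"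
  by (simp add: cmult.rep_eq cscale.rep_eq)

lemma coord_simps [simp]:
  "coord 0 n = 0" "coord (x + y) n = coord x n + coord y n" "coord (x - y) n = coord x n - coord y n"
  "coord (- x) n = - coord x n"
  "coord (ebasis m) n = (if n = m then 1 else 0)"
  by (simp_all add: zero_ell2.rep_eq plus_ell2.rep_eq minus_ell2.rep_eq uminus_ell2.rep_eq ebasis.rep_eq)

lemma is_adjoint_cmult: "is_adjoint (cmult c) (cmult (cnj c))"
  by (simp add: is_adjoint_def inner_ell2_def inner_complex_def algebra_simps)

lemma cmult_1: "cmult 1 = id_blinfun"
  and cmult_add: "cmult (c + d) = cmult c + cmult d"
  and cmult_mult: "cmult (c * d) = cmult c o\<^sub>L cmult d"
  by (auto intro!: blinfun_eqI ell2_eqI simp: blinfun.add_left algebra_simps)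

lemma cmult_minus_1: "cmult (- 1) = - id_blinfun"
  by (auto intro!: blinfun_eqI ell2_eqI simp: blinfun.minus_left)

lemma norm_cmult_compose: "norm (cmult c o\<^sub>L a) = cmod c * norm a"
proof -
  have le: "norm (cmult c) \<le> cmod c" for c
    by (rule norm_blinfun_bound) (auto simp: cmult.rep_eq norm_cscale_le)
  have *: "norm (cmult c o\<^sub>L a) \<le> cmod c * norm a" for c a
    by (rule order_trans[OF norm_blinfun_compose]) (simp add: le mult_right_mono)
  show ?thesis
  proof (cases "c = 0")
    case False
    \<comment> \<open>The reverse inequality is the upper bound applied to the inverse
      scalar.\<close>
    have "norm (cmult (inverse c) o\<^sub>L (cmult c o\<^sub>L a)) \<le> cmod (inverse c) * norm (cmult c o\<^sub>L a)"
      by (rule *)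
    also have "cmult (inverse c) o\<^sub>L (cmult c o\<^sub>L a) = a"
      using False by (auto intro!: blinfun_eqI ell2_eqI)
    finally show ?thesis
      using *[of c a] False by (simp add: norm_divide field_simps)
  qed (use *[of c a] in simp)
qed

text \<open>Pairing with \<open>ebasis m\<close> alone sees only the real part of a coordinate;
  letting c vary recovers all of it.\<close>

lemma inner_cmult_ebasis: "inner x (cmult c (ebasis m)) = inner (coord x m) c"
proof -
  have "(\<lambda>n. inner (coord x n) (coord (cmult c (ebasis m)) n)) = (\<lambda>n. if n = m then inner (coord x m) c else 0)"
    by auto
  then show ?thesis by (simp add: inner_ell2_def sums_single[THEN sums_unique, symmetric])
qed

section \<open>The weighted shift and its adjoint\<close>

definition weight :: "nat \<Rightarrow> real" where
  "weight n = 1 - (1/2) ^ n"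

lemma weight_0 [simp]: "weight 0 = 0"
  and abs_weight_le: "\<bar>weight n\<bar> \<le> 1"
  by (auto simp: weight_def power_le_one)

text \<open>\<open>weight n\<close> belongs to the step from n - 1 to its target n. At n = 0
  truncated subtraction yields \<open>x 0\<close>, which \<open>weight 0 = 0\<close>
  removes.\<close>

lift_definition up :: "ell2 \<Rightarrow> ell2" is "\<lambda>x n. weight n *\<^sub>R x (n - 1)"
proof -
  fix x :: "nat \<Rightarrow> complex" assume "summable (\<lambda>n. (cmod (x n))\<^sup>2)"
  then have "summable (\<lambda>n. (cmod (of_real (weight (Suc n)) * x n))\<^sup>2)"
    by (rule summable_norm_sq_mult[where C = 1]) (simp add: abs_weight_le)
  then show "summable (\<lambda>n. (cmod (weight n *\<^sub>R x (n - 1)))\<^sup>2)"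
    by (subst summable_Suc_iff[symmetric]) (simp add: scaleR_conv_of_real)
qed

lift_definition down :: "ell2 \<Rightarrow> ell2" is "\<lambda>x n. weight (Suc n) *\<^sub>R x (Suc n)"
proof -
  fix x :: "nat \<Rightarrow> complex" assume "summable (\<lambda>n. (cmod (x n))\<^sup>2)"
  then have "summable (\<lambda>n. (cmod (x (Suc n)))\<^sup>2)"
    by (subst summable_Suc_iff)
  then have "summable (\<lambda>n. (cmod (of_real (weight (Suc n)) * x (Suc n)))\<^sup>2)"
    by (rule summable_norm_sq_mult[where C = 1]) (simp add: abs_weight_le)
  then show "summable (\<lambda>n. (cmod (weight (Suc n) *\<^sub>R x (Suc n)))\<^sup>2)"
    by (simp add: scaleR_conv_of_real)
qed

lemma cmod_weight_le: "(cmod (weight n *\<^sub>R z))\<^sup>2 \<le> (cmod z)\<^sup>2"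
  using mult_right_mono[OF abs_weight_le[of n] norm_ge_zero[of z]] by (intro power_mono) auto

lemma norm_up_le: "norm (up x) \<le> norm x"
proof (rule norm_ell2_le)
  fix N
  show "(\<Sum>n<N. (cmod (coord (up x) n))\<^sup>2) \<le> (norm x)\<^sup>2"
  proof (cases N)
    case (Suc M)
    have "(\<Sum>n<N. (cmod (coord (up x) n))\<^sup>2) = (\<Sum>n<M. (cmod (weight (Suc n) *\<^sub>R coord x n))\<^sup>2)"
      unfolding Suc sum.lessThan_Suc_shift by (simp add: up.rep_eq)
    also have "\<dots> \<le> (\<Sum>n<M. (cmod (coord x n))\<^sup>2)"
      by (intro sum_mono cmod_weight_le)
    also note sum_coord_le_norm_sq
    finally show ?thesis .
  qed simp
qed simp

lemma norm_down_le: "norm (down x) \<le> norm x"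
proof (rule norm_ell2_le)
  fix N
  have "(\<Sum>n<N. (cmod (coord (down x) n))\<^sup>2) \<le> (\<Sum>n<N. (cmod (coord x (Suc n)))\<^sup>2)"
    unfolding down.rep_eq by (intro sum_mono cmod_weight_le)
  also have "\<dots> \<le> (\<Sum>n<Suc N. (cmod (coord x n))\<^sup>2)"
    unfolding sum.lessThan_Suc_shift by simp
  also note sum_coord_le_norm_sq
  finally show "(\<Sum>n<N. (cmod (coord (down x) n))\<^sup>2) \<le> (norm x)\<^sup>2" .
qed simp

lift_definition wshift :: "ell2 \<Rightarrow>\<^sub>L ell2" is up
proof (rule bounded_linear_intro[where K = 1])
  fix x y r
  show "up (x + y) = up x + up y" by transfer (simp add: algebra_simps)
  show "up (r *\<^sub>R x) = r *\<^sub>R up x" by transfer (simp add: algebra_simps)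
  show "norm (up x) \<le> norm x * 1" using norm_up_le[of x] by simp
qed

lift_definition wshift_adj :: "ell2 \<Rightarrow>\<^sub>L ell2" is down
proof (rule bounded_linear_intro[where K = 1])
  fix x y r
  show "down (x + y) = down x + down y" by transfer (simp add: algebra_simps)
  show "down (r *\<^sub>R x) = r *\<^sub>R down x" by transfer (simp add: algebra_simps)
  show "norm (down x) \<le> norm x * 1" using norm_down_le[of x] by simp
qed

lemma coord_wshift [simp]: "coord (wshift x) n = weight n *\<^sub>R coord x (n - 1)"
  and coord_wshift_adj [simp]: "coord (wshift_adj x) n = weight (Suc n) *\<^sub>R coord x (Suc n)"
  by (simp_all add: wshift.rep_eq wshift_adj.rep_eq up.rep_eq down.rep_eq)

lemma is_adjoint_wshift: "is_adjoint wshift wshift_adj"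
proof -
  have "inner (wshift x) y = inner x (wshift_adj y)" for x y
  proof -
    \<comment> \<open>The term at 0 vanishes because \<open>weight 0 = 0\<close>, so the sum may be
      reindexed by successors.\<close>
    have "inner (wshift x) y = (\<Sum>n. inner (coord (wshift x) (Suc n)) (coord y (Suc n)))"
      unfolding inner_ell2_def by (subst suminf_split_head[OF summable_inner[OF summable_coord summable_coord]]) simp
    also have "\<dots> = inner x (wshift_adj y)"
      by (simp add: inner_ell2_def)
    finally show ?thesis .
  qed
  then show ?thesis by (simp add: is_adjoint_def)
qed

text \<open>Products grow only by a generator on the left, so inductions have to treat nothing more
  general than left multiplication by one of the two shifts or by a scalar. Closure under
  composition and adjoints follows.\<close>

inductive_set wshift_alg :: "(ell2 \<Rightarrow>\<^sub>L ell2) set" where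
  one: "id_blinfun \<in> wshift_alg"
| shift: "a \<in> wshift_alg \<Longrightarrow> wshift o\<^sub>L a \<in> wshift_alg"
| shift_adj: "a \<in> wshift_alg \<Longrightarrow> wshift_adj o\<^sub>L a \<in> wshift_alg"
| add: "a \<in> wshift_alg \<Longrightarrow> b \<in> wshift_alg \<Longrightarrow> a + b \<in> wshift_alg"
| smult: "a \<in> wshift_alg \<Longrightarrow> cmult c o\<^sub>L a \<in> wshift_alg"

lemma compose_assoc: "(a o\<^sub>L b) o\<^sub>L c = a o\<^sub>L (b o\<^sub>L c)"
  by (rule blinfun_eqI) simp

lemma compose_add_left: "(a + b) o\<^sub>L c = (a o\<^sub>L c) + (b o\<^sub>L c)"
  and compose_add_right: "a o\<^sub>L (b + c) = (a o\<^sub>L b) + (a o\<^sub>L c)"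
  by (rule blinfun_eqI, simp add: blinfun.add_left blinfun.add_right)+

lemma id_compose [simp]: "id_blinfun o\<^sub>L a = a" "a o\<^sub>L id_blinfun = a"
  by (rule blinfun_eqI, simp)+

lemma wshift_alg_compose: "a \<in> wshift_alg \<Longrightarrow> b \<in> wshift_alg \<Longrightarrow> a o\<^sub>L b \<in> wshift_alg"
  by (induction a rule: wshift_alg.induct)
    (auto simp: compose_assoc compose_add_left intro: wshift_alg.intros)

lemma wshift_alg_generators:
  "wshift \<in> wshift_alg" "wshift_adj \<in> wshift_alg" "cmult c \<in> wshift_alg"
  using wshift_alg.intros(2,3,5)[OF wshift_alg.one] by simp_all

lemma wshift_alg_minus: "a \<in> wshift_alg \<Longrightarrow> - a \<in> wshift_alg"
proof -
  have "- a = cmult (- 1) o\<^sub>L a" by (rule blinfun_eqI) (simp add: cmult_minus_1 blinfun.minus_left)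
  then show "a \<in> wshift_alg \<Longrightarrow> - a \<in> wshift_alg" by (simp add: wshift_alg.smult)
qed

lemma wshift_alg_zero: "0 \<in> wshift_alg"
  using wshift_alg.add[OF wshift_alg.one wshift_alg_minus[OF wshift_alg.one]] by simp

text \<open>This is complex linearity of the elements, which their type does not provide.\<close>

lemma wshift_alg_cmult_commute: "a \<in> wshift_alg \<Longrightarrow> a o\<^sub>L cmult c = cmult c o\<^sub>L a"
proof (induction a rule: wshift_alg.induct)
  case (shift a)
  have "wshift o\<^sub>L cmult c = cmult c o\<^sub>L wshift"
    by (auto intro!: blinfun_eqI ell2_eqI)
  then show ?case using shift by (metis compose_assoc)
next
  case (shift_adj a)
  have "wshift_adj o\<^sub>L cmult c = cmult c o\<^sub>L wshift_adj"
    by (auto intro!: blinfun_eqI ell2_eqI)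
  then show ?case using shift_adj by (metis compose_assoc)
next
  case (smult a d)
  then show ?case by (simp add: compose_assoc) (simp add: compose_assoc[symmetric] cmult_mult[symmetric] mult.commute)
qed (auto simp: compose_add_left compose_add_right)

text \<open>The generators are closed under adjoints, and adjoints reverse products;
  \<open>wshift_alg_compose\<close> absorbs the reversed order.\<close>

lemma wshift_alg_adjoint: "a \<in> wshift_alg \<Longrightarrow> \<exists>b\<in>wshift_alg. is_adjoint a b"
proof (induction a rule: wshift_alg.induct)
  case one
  show ?case by (blast intro: wshift_alg.one is_adjoint_id)
next
  case (shift a)
  then show ?case
    by (meson is_adjoint_compose is_adjoint_wshift wshift_alg_compose wshift_alg_generators)
next
  case (shift_adj a)
  then show ?case
    by (meson is_adjoint_compose is_adjoint_sym is_adjoint_wshift wshift_alg_compose wshift_alg_generators)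
next
  case (add a b)
  then show ?case by (meson is_adjoint_add wshift_alg.add)
next
  case (smult a c)
  then show ?case
    by (meson is_adjoint_compose is_adjoint_cmult wshift_alg_compose wshift_alg_generators)
qed

subsection \<open>Symbols\<close>

text \<open>Target indices range over the integers; entries at negative targets are 0. The defining equation of
  a symbol then also holds at the boundary, which is what makes it stable under both shifts.\<close>

definition entry :: "(ell2 \<Rightarrow>\<^sub>L ell2) \<Rightarrow> nat \<Rightarrow> int \<Rightarrow> complex" where
  "entry a n m = (if m < 0 then 0 else coord (a (ebasis n)) (nat m))"

definition is_symbol :: "(ell2 \<Rightarrow>\<^sub>L ell2) \<Rightarrow> (int \<Rightarrow> complex poly) \<Rightarrow> bool" where
  "is_symbol a P \<longleftrightarrow> finite {k. P k \<noteq> 0} \<and>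
     (\<forall>n m. entry a n m = poly (P (m - int n)) ((1/2) ^ n))"

definition symbol :: "(ell2 \<Rightarrow>\<^sub>L ell2) \<Rightarrow> int \<Rightarrow> complex poly" where
  "symbol a = (THE P. is_symbol a P)"

text \<open>Otherwise the difference would be a nonzero polynomial with infinitely many
  roots.\<close>

lemma poly_eq_if_eq_half_powers:
  fixes p q :: "complex poly"
  assumes "\<And>n. poly p ((1/2) ^ n) = poly q ((1/2) ^ n)"
  shows "p = q"
proof (rule ccontr)
  assume "p \<noteq> q"
  then have "finite {x. poly (p - q) x = 0}"
    by (intro poly_roots_finite) simp
  moreover have "range (\<lambda>n. (1/2) ^ n) \<subseteq> {x. poly (p - q) x = 0}"
    using assms by auto
  ultimately have "finite (range (\<lambda>n. (1/2 :: complex) ^ n))"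
    by (rule finite_subset[rotated])
  moreover have "inj (\<lambda>n. (1/2 :: complex) ^ n)"
  proof (rule injI)
    fix m n assume "(1/2 :: complex) ^ m = (1/2) ^ n"
    then have "cmod ((1/2) ^ m) = cmod ((1/2) ^ n)" by simp
    then have "(1/2 :: real) ^ m = (1/2) ^ n" by (simp add: norm_power)
    then show "m = n" by (simp add: power_inject_exp')
  qed
  ultimately show False
    using finite_imageD infinite_UNIV_nat by blast
qed

lemma is_symbol_unique:
  assumes "is_symbol a P" "is_symbol a Q"
  shows "P = Q"
proof
  fix k
  have "poly (P k) ((1/2) ^ n) = poly (Q k) ((1/2) ^ n)" for n
    using assms unfolding is_symbol_def by (metis add_diff_cancel_right')
  then show "P k = Q k"
    by (rule poly_eq_if_eq_half_powers)
qed

lemma symbol_eq: "is_symbol a P \<Longrightarrow> symbol a = P"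
  unfolding symbol_def by (rule the_equality) (auto intro: is_symbol_unique)

text \<open>With offset k = m - n and t = 2^-n this reads 2^-k t = 2^-m. It turns the weight at
  target m into the polynomial 1 - 2^-k t, whose coefficients depend only on the offset.\<close>

lemma half_powi_mult: "(1/2 :: complex) powi (m - int n) * (1/2) ^ n = (1/2) powi m"
  by (simp add: power_int_diff)

lemma of_real_weight: "m \<ge> 0 \<Longrightarrow> complex_of_real (weight (nat m)) = 1 - (1/2) powi m"
  by (simp add: weight_def power_int_def)

lemma finite_shift_support:
  fixes P :: "int \<Rightarrow> 'a::zero"
  assumes "finite {k. P k \<noteq> 0}"
  shows "finite {k. P (k + d) \<noteq> 0}"
proof -
  have "{k. P (k + d) \<noteq> 0} = (\<lambda>k. k - d) ` {k. P k \<noteq> 0}"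
    by (auto intro: rev_image_eqI[where x = "_ + d"])
  then show ?thesis using assms by simp
qed

section \<open>Symbols of the identity, shifts, sums and scalar multiples\<close>

lemma is_symbol_id: "is_symbol id_blinfun (\<lambda>k. if k = 0 then 1 else 0)"
  unfolding is_symbol_def entry_def by (auto simp: if_distrib)

lemma is_symbol_zero: "is_symbol 0 (\<lambda>k. 0)"
  by (simp add: is_symbol_def entry_def)

lemma is_symbol_wshift:
  assumes "is_symbol a P"
  shows "is_symbol (wshift o\<^sub>L a) (\<lambda>k. [:1, - ((1/2) powi k):] * P (k - 1))"
proof -
  have fin: "finite {k. [:1, - ((1/2) powi k):] * P (k - 1) \<noteq> 0}"
    using finite_shift_support[of P "-1"] assms
    by (auto simp: is_symbol_def elim!: finite_subset[rotated])
  have "entry (wshift o\<^sub>L a) n m = poly ([:1, - ((1/2) powi (m - int n)):] * P (m - int n - 1)) ((1/2) ^ n)" for n m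
  proof -
    have "poly ([:1, - ((1/2) powi (m - int n)):] * P (m - int n - 1)) ((1/2) ^ n)
        = (1 - (1/2) powi m) * entry a n (m - 1)"
      using assms unfolding half_powi_mult[of m n, symmetric]
      by (simp add: is_symbol_def algebra_simps)
    \<comment> \<open>For m \<le> 0 both sides vanish: the left one because its target m - 1 is
      negative, the right one by convention or, at m = 0, by \<open>weight 0 = 0\<close>.\<close>
    also have "\<dots> = entry (wshift o\<^sub>L a) n m"
      by (cases "m \<le> 0")
        (auto simp: entry_def scaleR_conv_of_real of_real_weight nat_diff_distrib)
    finally show ?thesis by simp
  qed
  with fin show ?thesis by (simp add: is_symbol_def)
qed

lemma is_symbol_wshift_adj:
  assumes "is_symbol a P"
  shows "is_symbol (wshift_adj o\<^sub>L a) (\<lambda>k. [:1, - ((1/2) powi (k + 1)):] * P (k + 1))"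
proof -
  have fin: "finite {k. [:1, - ((1/2) powi (k + 1)):] * P (k + 1) \<noteq> 0}"
    using finite_shift_support[of P 1] assms
    by (auto simp: is_symbol_def elim!: finite_subset[rotated])
  have "entry (wshift_adj o\<^sub>L a) n m =
      poly ([:1, - ((1/2) powi (m - int n + 1)):] * P (m - int n + 1)) ((1/2) ^ n)" for n m
  proof -
    have "poly ([:1, - ((1/2) powi (m - int n + 1)):] * P (m - int n + 1)) ((1/2) ^ n)
        = (1 - (1/2) powi (m + 1)) * entry a n (m + 1)"
      using assms unfolding half_powi_mult[of "m + 1" n, symmetric]
      by (simp add: is_symbol_def algebra_simps)
    also have "\<dots> = entry (wshift_adj o\<^sub>L a) n m"
    proof (cases "m < 0")
      case True
      \<comment> \<open>At m = -1 the entry of a at target 0 may be nonzero, but its factor 1 - 2^0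
        is zero; below that the entry itself is zero.\<close>
      then show ?thesis by (cases "m = -1") (auto simp: entry_def)
    next
      case False
      then have "Suc (nat m) = nat (m + 1)" by simp
      then show ?thesis
        using False by (simp add: entry_def scaleR_conv_of_real of_real_weight del: Suc_nat_eq_nat_zadd1)
    qed
    finally show ?thesis by simp
  qed
  with fin show ?thesis by (simp add: is_symbol_def)
qed

lemma is_symbol_add:
  assumes "is_symbol a P" "is_symbol b Q"
  shows "is_symbol (a + b) (\<lambda>k. P k + Q k)"
proof -
  have "{k. P k + Q k \<noteq> 0} \<subseteq> {k. P k \<noteq> 0} \<union> {k. Q k \<noteq> 0}" by auto
  moreover have "entry (a + b) n m = entry a n m + entry b n m" for n m
    by (simp add: entry_def blinfun.add_left)
  ultimately show ?thesis
    using assms by (auto simp: is_symbol_def elim: finite_subset)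
qed

lemma is_symbol_smult:
  assumes "is_symbol a P"
  shows "is_symbol (cmult c o\<^sub>L a) (\<lambda>k. smult c (P k))"
proof -
  have "{k. smult c (P k) \<noteq> 0} \<subseteq> {k. P k \<noteq> 0}" by auto
  moreover have "entry (cmult c o\<^sub>L a) n m = c * entry a n m" for n m
    by (simp add: entry_def)
  ultimately show ?thesis
    using assms by (auto simp: is_symbol_def elim: finite_subset)
qed

lemma is_symbol_symbol: "a \<in> wshift_alg \<Longrightarrow> is_symbol a (symbol a)"
proof -
  have "a \<in> wshift_alg \<Longrightarrow> \<exists>P. is_symbol a P"
    by (induction a rule: wshift_alg.induct)
      (use is_symbol_id is_symbol_wshift is_symbol_wshift_adj is_symbol_add is_symbol_smult in blast)+
  then show "a \<in> wshift_alg \<Longrightarrow> is_symbol a (symbol a)"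
    using symbol_eq by blast
qed

lemma finite_symbol: "a \<in> wshift_alg \<Longrightarrow> finite {k. symbol a k \<noteq> 0}"
  using is_symbol_symbol by (simp add: is_symbol_def)

lemmas symbol_id = symbol_eq[OF is_symbol_id]
  and symbol_zero = symbol_eq[OF is_symbol_zero]
  and symbol_wshift = symbol_eq[OF is_symbol_wshift[OF is_symbol_symbol]]
  and symbol_wshift_adj = symbol_eq[OF is_symbol_wshift_adj[OF is_symbol_symbol]]
  and symbol_add = symbol_eq[OF is_symbol_add[OF is_symbol_symbol is_symbol_symbol]]
  and symbol_smult = symbol_eq[OF is_symbol_smult[OF is_symbol_symbol]]

text \<open>All columns vanish, so a kills every basis vector and, by complex linearity, every
  complex multiple of one. Hence the adjoint has only zero coordinates, and a has the same norm as
  its adjoint.\<close>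

lemma symbol_eq_0_imp_eq_0:
  assumes "a \<in> wshift_alg" "\<And>k. symbol a k = 0"
  shows "a = 0"
proof -
  have basis: "a (ebasis n) = 0" for n
  proof (rule ell2_eqI)
    fix m
    have "entry a n (int m) = 0"
      using is_symbol_symbol[OF assms(1)] assms(2) by (simp add: is_symbol_def)
    then show "coord (a (ebasis n)) m = coord 0 m" by (simp add: entry_def)
  qed
  obtain b where b: "is_adjoint a b"
    using wshift_alg_adjoint[OF assms(1)] by blast
  have "b y = 0" for y
  proof (rule ell2_eqI)
    fix m
    have "inner (coord (b y) m) c = 0" for c
    proof -
      have "inner (coord (b y) m) c = inner (a (cmult c (ebasis m))) y"
        using b unfolding inner_cmult_ebasis[symmetric] is_adjoint_def by (metis inner_commute)
      also have "a (cmult c (ebasis m)) = cmult c (a (ebasis m))"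
        using wshift_alg_cmult_commute[OF assms(1), of c] by (metis blinfun_apply_blinfun_compose)
      also have "inner \<dots> y = 0"
        by (simp add: basis blinfun.zero_right)
      finally show ?thesis .
    qed
    then show "coord (b y) m = coord 0 m"
      by (metis coord_simps(1) inner_eq_zero_iff)
  qed
  then have "b = 0" by (simp add: blinfun_eqI)
  then show "a = 0"
    using norm_adjoint[OF b] by simp
qed

text \<open>The skew product: moving \<open>t\<close> past a step of length \<open>l\<close> replaces it by \<open>2\<^bsup>-l\<^esup>t\<close>.\<close>

lemma symbol_compose:
  assumes "a \<in> wshift_alg" "b \<in> wshift_alg"
  shows "symbol (a o\<^sub>L b) k =
    (\<Sum>l | symbol b l \<noteq> 0. symbol b l * pcompose (symbol a (k - l)) [:0, (1/2) powi l:])"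
  using assms(1)
proof (induction a arbitrary: k rule: wshift_alg.induct)
  case one
  have "symbol b k = (\<Sum>l | symbol b l \<noteq> 0. if l = k then symbol b k else 0)"
    by (simp add: sum.delta' finite_symbol[OF assms(2)])
  also have "\<dots> = (\<Sum>l | symbol b l \<noteq> 0. symbol b l * pcompose (symbol id_blinfun (k - l)) [:0, (1/2) powi l:])"
    by (rule sum.cong) (auto simp: symbol_id pcompose_1)
  finally show ?case by simp
next
  case (shift a)
  \<comment> \<open>After the substitution, the weight at offset k - l becomes the weight at offset
    k, as 2^-k t = 2^-(k-l) (2^-l t). It no longer depends on l and can be taken out of the
    sum.\<close>
  have eq: "[:1, - ((1/2) powi k):] = pcompose [:1, - ((1/2) powi (k - l)) :] [:0, (1/2 :: complex) powi l:]" for l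
    by (simp add: pcompose_pCons power_int_diff)
  show ?case
    unfolding compose_assoc symbol_wshift[OF wshift_alg_compose[OF shift.hyps assms(2)]] shift.IH
      symbol_wshift[OF shift.hyps] sum_distrib_left pcompose_mult eq[symmetric]
    by (rule sum.cong) (simp_all add: mult_ac diff_diff_eq add.commute)
next
  case (shift_adj a)
  have eq: "[:1, - ((1/2) powi (k + 1)):] = pcompose [:1, - ((1/2) powi (k - l + 1)) :] [:0, (1/2 :: complex) powi l:]" for l
    by (simp add: pcompose_pCons power_int_diff power_int_add)
  show ?case
    unfolding compose_assoc symbol_wshift_adj[OF wshift_alg_compose[OF shift_adj.hyps assms(2)]] shift_adj.IH
      symbol_wshift_adj[OF shift_adj.hyps] sum_distrib_left pcompose_mult eq[symmetric]
    by (rule sum.cong) (simp_all add: mult_ac algebra_simps)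
next
  case (add a a')
  show ?case
    unfolding compose_add_left symbol_add[OF wshift_alg_compose[OF add.hyps(1) assms(2)] wshift_alg_compose[OF add.hyps(2) assms(2)]]
      add.IH symbol_add[OF add.hyps] pcompose_add sum.distrib[symmetric]
    by (simp add: distrib_left)
next
  case (smult a c)
  show ?case
    unfolding compose_assoc symbol_smult[OF wshift_alg_compose[OF smult.hyps assms(2)]] smult.IH
      symbol_smult[OF smult.hyps] pcompose_smult
    using sum_distrib_left[of "[:c:]"] by simp
qed

lemma pcompose_power: "pcompose (p ^ n) r = pcompose p r ^ n"
  by (induction n) (simp_all add: pcompose_1 pcompose_mult)

text \<open>The substitution of 2^-l t for t changes t^r only by a nonzero scalar, so in the skew
  product the orders of divisibility by t still add up.\<close>

lemma symbol_compose_dvd: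
  assumes "a \<in> wshift_alg" "b \<in> wshift_alg"
    and "\<And>k. [:0, 1:] ^ r dvd symbol a k" "\<And>k. [:0, 1:] ^ s dvd symbol b k"
  shows "[:0, 1:] ^ (s + r) dvd symbol (a o\<^sub>L b) k"
  unfolding symbol_compose[OF assms(1,2)]
proof (rule dvd_sum)
  fix l
  obtain q where q: "symbol a (k - l) = [:0, 1:] ^ r * q"
    using assms(3) by (auto elim: dvdE)
  have "pcompose (symbol a (k - l)) [:0, (1/2) powi l:] =
      (smult ((1/2) powi l) [:0, 1:]) ^ r * pcompose q [:0, (1/2) powi l:]"
    by (simp add: q pcompose_mult pcompose_power pcompose_pCons)
  then have "[:0, 1:] ^ r dvd pcompose (symbol a (k - l)) [:0, (1/2) powi l:]"
    by (simp add: smult_power dvd_smult del: smult_pCons)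
  then show "[:0, 1:] ^ (s + r) dvd symbol b l * pcompose (symbol a (k - l)) [:0, (1/2) powi l:]"
    unfolding power_add by (rule mult_dvd_mono[OF assms(4)])
qed

text \<open>The reduction modulo \<open>t\<close>, with values in a field so that matrices over it have two-sided inverses.\<close>

definition principal_symbol :: "(ell2 \<Rightarrow>\<^sub>L ell2) \<Rightarrow> complex fls" where
  "principal_symbol a = Abs_fls (\<lambda>k. coeff (symbol a k) 0)"

lemma nth_principal_symbol:
  assumes "a \<in> wshift_alg"
  shows "fls_nth (principal_symbol a) k = coeff (symbol a k) 0"
proof -
  \<comment> \<open>\<open>Abs_fls\<close> keeps the given coefficients provided that almost all of
    those at negative indices vanish.\<close>
  have "finite {n. coeff (symbol a (- int n)) 0 \<noteq> 0}"
  proof (rule finite_subset)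
    show "{n. coeff (symbol a (- int n)) 0 \<noteq> 0} \<subseteq> (\<lambda>n. - int n) -` {k. symbol a k \<noteq> 0}" by auto
    show "finite ((\<lambda>n. - int n) -` {k. symbol a k \<noteq> 0})"
      by (rule finite_vimageI[OF finite_symbol[OF assms]]) (auto simp: inj_def)
  qed
  then show ?thesis
    unfolding principal_symbol_def
    by (subst nth_Abs_fls) (auto simp: eventually_cofinite)
qed

lemma principal_symbol_id: "principal_symbol id_blinfun = 1"
  by (rule fls_eqI) (simp add: nth_principal_symbol[OF wshift_alg.one] symbol_id)

lemma principal_symbol_zero: "principal_symbol 0 = 0"
  by (rule fls_eqI) (simp add: nth_principal_symbol[OF wshift_alg_zero] symbol_zero)

lemma principal_symbol_add:
  "a \<in> wshift_alg \<Longrightarrow> b \<in> wshift_alg \<Longrightarrow> principal_symbol (a + b) = principal_symbol a + principal_symbol b"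
  by (rule fls_eqI) (simp add: nth_principal_symbol wshift_alg.add symbol_add)

lemma principal_symbol_wshift:
  "a \<in> wshift_alg \<Longrightarrow> principal_symbol (wshift o\<^sub>L a) = fls_X * principal_symbol a"
  by (rule fls_eqI) (simp add: nth_principal_symbol wshift_alg.shift symbol_wshift fls_X_times_conv_shift coeff_mult_0)

lemma principal_symbol_wshift_adj:
  "a \<in> wshift_alg \<Longrightarrow> principal_symbol (wshift_adj o\<^sub>L a) = fls_X_inv * principal_symbol a"
  by (rule fls_eqI) (simp add: nth_principal_symbol wshift_alg.shift_adj symbol_wshift_adj fls_X_inv_times_conv_shift coeff_mult_0)

lemma principal_symbol_smult:
  "a \<in> wshift_alg \<Longrightarrow> principal_symbol (cmult c o\<^sub>L a) = fls_const c * principal_symbol a"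
  by (rule fls_eqI) (simp add: nth_principal_symbol wshift_alg.smult symbol_smult)

text \<open>Modulo t the weights become 1, so the two shifts reduce to \<open>fls_X\<close> and its
  inverse and the noncommutativity disappears.\<close>

lemma principal_symbol_compose:
  assumes "a \<in> wshift_alg" "b \<in> wshift_alg"
  shows "principal_symbol (a o\<^sub>L b) = principal_symbol a * principal_symbol b"
  using assms(1)
  by (induction a rule: wshift_alg.induct)
    (simp_all add: assms(2) principal_symbol_id principal_symbol_add principal_symbol_wshift principal_symbol_wshift_adj
      principal_symbol_smult compose_assoc compose_add_left wshift_alg_compose algebra_simps)

lemma wshift_alg_sum: "(\<And>i. i \<in> I \<Longrightarrow> f i \<in> wshift_alg) \<Longrightarrow> sum f I \<in> wshift_alg"
  by (induction I rule: infinite_finite_induct) (auto simp: wshift_alg_zero wshift_alg.add)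

lemma wshift_alg_diff: "a \<in> wshift_alg \<Longrightarrow> b \<in> wshift_alg \<Longrightarrow> a - b \<in> wshift_alg"
  using wshift_alg.add[OF _ wshift_alg_minus] by fastforce

lemma symbol_sum:
  "(\<And>i. i \<in> I \<Longrightarrow> f i \<in> wshift_alg) \<Longrightarrow> symbol (sum f I) k = (\<Sum>i\<in>I. symbol (f i) k)"
  by (induction I rule: infinite_finite_induct) (auto simp: symbol_zero symbol_add wshift_alg_sum)

lemma principal_symbol_sum:
  "(\<And>i. i \<in> I \<Longrightarrow> f i \<in> wshift_alg) \<Longrightarrow> principal_symbol (sum f I) = (\<Sum>i\<in>I. principal_symbol (f i))"
  by (induction I rule: infinite_finite_induct)
    (auto simp: principal_symbol_zero principal_symbol_add wshift_alg_sum)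

lemma principal_symbol_diff:
  assumes "a \<in> wshift_alg" "b \<in> wshift_alg"
  shows "principal_symbol (a - b) = principal_symbol a - principal_symbol b"
  using principal_symbol_add[OF wshift_alg_diff[OF assms] assms(2)] by simp

subsection \<open>Stable finiteness\<close>

lemma field_matrix_left_right_inverse:
  fixes f g :: "nat \<Rightarrow> nat \<Rightarrow> 'a::field"
  assumes "\<And>i j. i < n \<Longrightarrow> j < n \<Longrightarrow> (\<Sum>k<n. f i k * g k j) = (if i = j then 1 else 0)"
    and "i < n" "j < n"
  shows "(\<Sum>k<n. g i k * f k j) = (if i = j then 1 else 0)"
proof -
  let ?F = "mat n n (\<lambda>(i, j). f i j)" and ?G = "mat n n (\<lambda>(i, j). g i j)"
  have "?F * ?G = 1\<^sub>m n"
    by (rule eq_matI) (auto simp: scalar_prod_def assms(1) atLeast0LessThan)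
  then have "?G * ?F = 1\<^sub>m n"
    by (intro mat_mult_left_right_inverse[of ?F n ?G]) auto
  then have "index_mat (?G * ?F) (i, j) = index_mat (1\<^sub>m n) (i, j)" by simp
  then show ?thesis
    using assms(2,3) by (simp add: scalar_prod_def atLeast0LessThan)
qed

section \<open>Matrices of operators\<close>

lemma compose_sum_left: "(\<Sum>i\<in>I. f i) o\<^sub>L b = (\<Sum>i\<in>I. f i o\<^sub>L b)"
  and compose_sum_right: "b o\<^sub>L (\<Sum>i\<in>I. f i) = (\<Sum>i\<in>I. b o\<^sub>L f i)"
  by (rule blinfun_eqI, simp add: blinfun.sum_left blinfun.sum_right)+

lemma compose_diff_left: "(a - b) o\<^sub>L c = (a o\<^sub>L c) - (b o\<^sub>L c)"
  and compose_diff_right: "a o\<^sub>L (b - c) = (a o\<^sub>L b) - (a o\<^sub>L c)"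
  by (rule blinfun_eqI, simp add: blinfun.diff_left blinfun.diff_right)+

lemma compose_zero: "0 o\<^sub>L a = 0" "a o\<^sub>L 0 = 0"
  by (rule blinfun_eqI, simp)+

text \<open>For Q = 1 - GF with FG = 1: FQ = F - (FG)F = 0, hence QQ = Q - G(FQ) = Q.\<close>

lemma one_minus_right_left_idempotent:
  fixes f g :: "nat \<Rightarrow> nat \<Rightarrow> ('a::real_normed_vector \<Rightarrow>\<^sub>L 'a)"
  assumes fg: "\<And>i j. i < n \<Longrightarrow> j < n \<Longrightarrow> (\<Sum>k<n. f i k o\<^sub>L g k j) = (if i = j then id_blinfun else 0)"
    and q: "\<And>i j. q i j = (if i = j then id_blinfun else 0) - (\<Sum>k<n. g i k o\<^sub>L f k j)"
    and "i < n" "j < n"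
  shows "(\<Sum>k<n. q i k o\<^sub>L q k j) = q i j"
proof -
  have fq: "(\<Sum>k<n. f p k o\<^sub>L q k j) = 0" if "p < n" for p
  proof -
    have "(\<Sum>k<n. f p k o\<^sub>L (\<Sum>r<n. g k r o\<^sub>L f r j)) = (\<Sum>r<n. (\<Sum>k<n. f p k o\<^sub>L g k r) o\<^sub>L f r j)"
      unfolding compose_sum_left compose_sum_right compose_assoc by (rule sum.swap)
    also have "\<dots> = (\<Sum>r<n. if r = p then f p j else 0)"
      using that by (intro sum.cong) (auto simp: fg compose_zero)
    also have "\<dots> = f p j" using that by simp
    finally have "(\<Sum>k<n. f p k o\<^sub>L (\<Sum>r<n. g k r o\<^sub>L f r j)) = f p j" .
    moreover have "(\<Sum>k<n. f p k o\<^sub>L (if k = j then id_blinfun else 0)) = (\<Sum>k<n. if k = j then f p j else 0)"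
      by (intro sum.cong) (auto simp: compose_zero)
    ultimately show ?thesis
      using \<open>j < n\<close> by (simp add: q compose_diff_right sum_subtractf)
  qed
  have "(\<Sum>k<n. (\<Sum>r<n. g i r o\<^sub>L f r k) o\<^sub>L q k j) = (\<Sum>r<n. g i r o\<^sub>L (\<Sum>k<n. f r k o\<^sub>L q k j))"
    unfolding compose_sum_left compose_sum_right compose_assoc by (rule sum.swap)
  also have "\<dots> = 0" by (simp add: fq compose_zero)
  finally have "(\<Sum>k<n. (\<Sum>r<n. g i r o\<^sub>L f r k) o\<^sub>L q k j) = 0" .
  moreover have "(\<Sum>k<n. (if i = k then id_blinfun else 0) o\<^sub>L q k j) = (\<Sum>k<n. if k = i then q i j else 0)"
    by (intro sum.cong) (auto simp: compose_zero)
  ultimately show ?thesis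
    using \<open>i < n\<close> by (subst q) (simp add: compose_diff_left sum_subtractf)
qed

lemma wshift_alg_stably_finite:
  fixes n :: nat
  assumes f: "\<And>i j. i < n \<Longrightarrow> j < n \<Longrightarrow> f i j \<in> wshift_alg"
    and g: "\<And>i j. i < n \<Longrightarrow> j < n \<Longrightarrow> g i j \<in> wshift_alg"
    and fg: "\<And>i j. i < n \<Longrightarrow> j < n \<Longrightarrow> (\<Sum>k<n. f i k o\<^sub>L g k j) = (if i = j then id_blinfun else 0)"
    and ij: "i < n" "j < n"
  shows "(\<Sum>k<n. g i k o\<^sub>L f k j) = (if i = j then id_blinfun else 0)"
proof -
  define q where "q i j = (if i = j then id_blinfun else 0) - (\<Sum>k<n. g i k o\<^sub>L f k j)" for i j
  have delta: "(if i = j then id_blinfun else 0) \<in> wshift_alg" for i j :: nat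
    by (simp add: wshift_alg.one wshift_alg_zero)
  have gf: "(\<Sum>k<n. g i k o\<^sub>L f k j) \<in> wshift_alg" if "i < n" "j < n" for i j
    using that by (intro wshift_alg_sum wshift_alg_compose f g) auto
  have q_alg: "q i j \<in> wshift_alg" if "i < n" "j < n" for i j
    unfolding q_def by (rule wshift_alg_diff[OF delta gf[OF that]])
  have ps_delta: "principal_symbol (if i = j then id_blinfun else 0) = (if i = j then 1 else 0)" for i j :: nat
    by (simp add: principal_symbol_id principal_symbol_zero)
  \<comment> \<open>Modulo t the matrices have entries in the field of Laurent series, where a
    one-sided inverse of a square matrix is two-sided.\<close>
  have "(\<Sum>k<n. principal_symbol (f i k) * principal_symbol (g k j)) = (if i = j then 1 else 0)"
    if "i < n" "j < n" for i j
  proof -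
    have "(\<Sum>k<n. principal_symbol (f i k) * principal_symbol (g k j)) = principal_symbol (\<Sum>k<n. f i k o\<^sub>L g k j)"
      using that by (subst principal_symbol_sum)
        (auto intro!: wshift_alg_compose sum.cong f g simp: principal_symbol_compose f g)
    then show ?thesis using that by (simp add: fg ps_delta)
  qed
  note ps = field_matrix_left_right_inverse[OF this]
  have ps_q: "principal_symbol (q i j) = 0" if "i < n" "j < n" for i j
  proof -
    have "principal_symbol (\<Sum>k<n. g i k o\<^sub>L f k j) = (\<Sum>k<n. principal_symbol (g i k) * principal_symbol (f k j))"
      using that by (subst principal_symbol_sum)
        (auto intro!: wshift_alg_compose sum.cong f g simp: principal_symbol_compose f g)
    then show ?thesis
      using that by (simp add: q_def principal_symbol_diff[OF delta gf] ps_delta ps)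
  qed
  \<comment> \<open>A vanishing constant coefficient is divisibility by t.\<close>
  have dvd1: "[:0, 1:] ^ 1 dvd symbol (q i j) k" if "i < n" "j < n" for i j k
    using nth_principal_symbol[OF q_alg[OF that], of k] ps_q[OF that]
    by (simp add: poly_eq_0_iff_dvd[of _ 0, simplified, symmetric] poly_0_coeff_0)
  have dvd: "[:0, 1:] ^ Suc s dvd symbol (q i j) k" if "i < n" "j < n" for s i j k
    using that
  proof (induction s arbitrary: i j k)
    case 0
    then show ?case using dvd1 by simp
  next
    case (Suc s)
    \<comment> \<open>In an entry of Q = QQ, the left factor of each product contributes one t and
      the right factor contributes t^(s+1) by induction.\<close>
    have "[:0, 1:] ^ (Suc s + 1) dvd symbol (q i l o\<^sub>L q l j) k" if "l < n" for l
      using Suc that by (intro symbol_compose_dvd q_alg dvd1)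
    moreover have "symbol (q i j) k = (\<Sum>l<n. symbol (q i l o\<^sub>L q l j) k)"
      using Suc.prems
      by (subst one_minus_right_left_idempotent[OF fg q_def, symmetric])
        (auto intro!: symbol_sum wshift_alg_compose q_alg)
    ultimately show ?case by (auto intro: dvd_sum)
  qed
  have "symbol (q i j) k = 0" for k
  proof (rule ccontr)
    assume nz: "symbol (q i j) k \<noteq> 0"
    \<comment> \<open>A nonzero polynomial cannot be divisible by a power of t beyond its
      degree.\<close>
    have "degree ([:0, 1:] ^ Suc (degree (symbol (q i j) k)) :: complex poly) \<le> degree (symbol (q i j) k)"
      by (rule dvd_imp_degree_le[OF dvd[OF ij] nz])
    then show False by (simp add: degree_power_eq del: power_Suc)
  qed
  then have "q i j = 0"
    by (rule symbol_eq_0_imp_eq_0[OF q_alg[OF ij]])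
  then show ?thesis by (simp add: q_def)
qed

subsection \<open>The closure as an infinite C*-algebra\<close>

lemma closure_limit:
  fixes f :: "nat \<Rightarrow> 'a :: metric_space"
  shows "(\<And>n. f n \<in> S) \<Longrightarrow> f \<longlonglongrightarrow> l \<Longrightarrow> l \<in> closure S"
  unfolding closure_sequential by blast

text \<open>The Neumann series of e, telescoped against 1 - e. The closure conditions on S keep
  every partial sum in S, so the limit lies in its closure.\<close>

lemma neumann_left_inverse:
  fixes e :: "'a :: banach \<Rightarrow>\<^sub>L 'a"
  assumes "norm e < 1"
    and S: "id_blinfun \<in> S" "\<And>x y. x \<in> S \<Longrightarrow> y \<in> S \<Longrightarrow> x + y \<in> S" "\<And>x. x \<in> S \<Longrightarrow> x o\<^sub>L e \<in> S" "0 \<in> S"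
  shows "\<exists>d \<in> closure S. d o\<^sub>L (id_blinfun - e) = id_blinfun"
proof -
  define p where "p k = ((\<lambda>x. x o\<^sub>L e) ^^ k) id_blinfun" for k
  have p_Suc: "p (Suc k) = p k o\<^sub>L e" for k by (simp add: p_def)
  have norm_p: "norm (p k) \<le> norm e ^ k * norm (id_blinfun :: 'a \<Rightarrow>\<^sub>L 'a)" for k
  proof (induction k)
    case (Suc k)
    show ?case
      unfolding p_Suc using norm_blinfun_compose[of "p k" e] mult_right_mono[OF Suc norm_ge_zero[of e]]
      by (simp add: mult_ac)
  qed (simp add: p_def)
  have geo: "(\<lambda>k. norm e ^ k * norm (id_blinfun :: 'a \<Rightarrow>\<^sub>L 'a)) \<longlonglongrightarrow> 0"
    using assms(1) by (intro tendsto_mult_left_zero LIMSEQ_power_zero) auto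
  have "summable p"
    using assms(1) norm_p by (intro summable_comparison_test'[OF summable_mult2[OF summable_geometric]]) auto
  then have lim: "(\<lambda>m. \<Sum>k<m. p k) \<longlonglongrightarrow> suminf p"
    by (rule summable_LIMSEQ)
  have p_S: "p k \<in> S" for k
    by (induction k) (use S in \<open>auto simp: p_def\<close>)
  have "(\<Sum>k<m. p k) \<in> S" for m
    by (induction m) (auto simp: S p_S)
  from closure_limit[OF this lim] have "suminf p \<in> closure S" .
  moreover have "suminf p o\<^sub>L (id_blinfun - e) = id_blinfun"
  proof (rule LIMSEQ_unique)
    show "(\<lambda>m. (\<Sum>k<m. p k) o\<^sub>L (id_blinfun - e)) \<longlonglongrightarrow> (suminf p o\<^sub>L (id_blinfun - e))"
      by (intro bounded_bilinear.tendsto[OF bounded_bilinear_blinfun_compose] lim tendsto_const)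
    have "(\<Sum>k<m. p k) o\<^sub>L (id_blinfun - e) = id_blinfun - p m" for m
    proof (induction m)
      case (Suc m)
      then show ?case
        by (simp add: compose_add_left) (simp add: compose_diff_right p_Suc)
    qed (simp add: compose_zero, simp add: p_def)
    moreover have "(\<lambda>m. id_blinfun - p m) \<longlonglongrightarrow> id_blinfun - 0"
      by (intro tendsto_diff tendsto_const Lim_null_comparison[OF _ geo]) (simp add: norm_p)
    ultimately show "(\<lambda>m. (\<Sum>k<m. p k) o\<^sub>L (id_blinfun - e)) \<longlonglongrightarrow> id_blinfun"
      by simp
  qed
  ultimately show ?thesis by blast
qed

lemma norm_one_minus_wshift_adj_wshift: "norm (id_blinfun - (wshift_adj o\<^sub>L wshift)) \<le> 3/4"
proof (rule norm_blinfun_bound)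
  fix x
  show "norm ((id_blinfun - (wshift_adj o\<^sub>L wshift)) x) \<le> 3/4 * norm x"
  proof (rule norm_ell2_le_mult)
    fix n
    define h where "h = (1/2 :: real) ^ Suc n"
    have h: "0 \<le> h" "h \<le> 1/2"
      using power_le_one[of "1/2 :: real" n] by (auto simp: h_def)
    \<comment> \<open>The operator is diagonal with entries 1 - (1 - h)^2 = h (2 - h), where h =
      2^-(n+1) is at most 1/2. The bound 3/4 is the value at h = 1/2, that is at n = 0, and the
      first product is the factored difference from it.\<close>
    have "(1/2 - h) * (3/2 - h) = 3/4 - 2 * h + h * h" "h * (2 - h) = 2 * h - h * h"
      by (simp_all add: field_simps)
    moreover have "0 \<le> (1/2 - h) * (3/2 - h)" "0 \<le> h * (2 - h)"
      using h by (auto intro!: mult_nonneg_nonneg)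
    ultimately have "0 \<le> 3/4 - 2 * h + h * h" "0 \<le> 2 * h - h * h"
      by simp_all
    then have "\<bar>1 - (weight (Suc n))\<^sup>2\<bar> \<le> 3/4"
      unfolding weight_def h_def[symmetric] by (simp add: power2_eq_square algebra_simps)
    moreover have "coord ((id_blinfun - (wshift_adj o\<^sub>L wshift)) x) n = (1 - (weight (Suc n))\<^sup>2) *\<^sub>R coord x n"
      by (simp add: blinfun.diff_left power2_eq_square scaleR_diff_left)
    ultimately show "cmod (coord ((id_blinfun - (wshift_adj o\<^sub>L wshift)) x) n) \<le> 3/4 * cmod (coord x n)"
      using mult_right_mono[OF _ norm_ge_zero, of "\<bar>1 - (weight (Suc n))\<^sup>2\<bar>" "3/4" "coord x n"] by simp
  qed simp
qed simp

text \<open>Everything in the range of the shift has zeroth coordinate 0, so \<open>ebasis 0\<close>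
  is not reached.\<close>

lemma wshift_not_right_invertible: "wshift o\<^sub>L a \<noteq> id_blinfun"
proof
  assume "wshift o\<^sub>L a = id_blinfun"
  then have "wshift (a (ebasis 0)) = ebasis 0"
    by (metis blinfun_apply_blinfun_compose blinfun_apply_id_blinfun id_apply)
  then have "coord (wshift (a (ebasis 0))) 0 = coord (ebasis 0) 0" by simp
  then show False by simp
qed

section \<open>Products, sums and adjoints in the closure\<close>

lemma closure_wshift_alg_compose:
  assumes "a \<in> closure wshift_alg" "b \<in> closure wshift_alg"
  shows "a o\<^sub>L b \<in> closure wshift_alg"
proof -
  obtain f g where f: "\<And>n. f n \<in> wshift_alg" "f \<longlonglongrightarrow> a" and g: "\<And>n. g n \<in> wshift_alg" "g \<longlonglongrightarrow> b"
    using assms unfolding closure_sequential by blast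
  have "(\<lambda>n. f n o\<^sub>L g n) \<longlonglongrightarrow> (a o\<^sub>L b)"
    by (rule bounded_bilinear.tendsto[OF bounded_bilinear_blinfun_compose f(2) g(2)])
  then show ?thesis
    by (rule closure_limit[rotated]) (intro wshift_alg_compose f g)
qed

lemma closure_wshift_alg_add:
  assumes "a \<in> closure wshift_alg" "b \<in> closure wshift_alg"
  shows "a + b \<in> closure wshift_alg"
proof -
  obtain f g where f: "\<And>n. f n \<in> wshift_alg" "f \<longlonglongrightarrow> a" and g: "\<And>n. g n \<in> wshift_alg" "g \<longlonglongrightarrow> b"
    using assms unfolding closure_sequential by blast
  have "(\<lambda>n. f n + g n) \<longlonglongrightarrow> a + b"
    by (rule tendsto_add[OF f(2) g(2)])
  then show ?thesis
    by (rule closure_limit[rotated]) (intro wshift_alg.add f g)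
qed

lemma closure_wshift_alg_generators:
  "wshift \<in> closure wshift_alg" "wshift_adj \<in> closure wshift_alg" "cmult c \<in> closure wshift_alg"
  "id_blinfun \<in> closure wshift_alg" "0 \<in> closure wshift_alg"
  using closure_subset wshift_alg_generators wshift_alg.one wshift_alg_zero by blast+

lemma closure_wshift_alg_cmult_commute:
  assumes "a \<in> closure wshift_alg"
  shows "a o\<^sub>L cmult c = cmult c o\<^sub>L a"
proof -
  obtain f where f: "\<And>n. f n \<in> wshift_alg" "f \<longlonglongrightarrow> a"
    using assms unfolding closure_sequential by blast
  note lim = bounded_bilinear.tendsto[OF bounded_bilinear_blinfun_compose]
  have "(\<lambda>n. f n o\<^sub>L cmult c) \<longlonglongrightarrow> (a o\<^sub>L cmult c)"
    by (rule lim[OF f(2) tendsto_const])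
  moreover have "(\<lambda>n. f n o\<^sub>L cmult c) \<longlonglongrightarrow> (cmult c o\<^sub>L a)"
    unfolding wshift_alg_cmult_commute[OF f(1)] by (rule lim[OF tendsto_const f(2)])
  ultimately show ?thesis by (rule LIMSEQ_unique)
qed

lemma closure_wshift_alg_adjoint:
  assumes "a \<in> closure wshift_alg"
  shows "is_adjoint a (adjoint_of a)" "adjoint_of a \<in> closure wshift_alg"
proof -
  obtain f where f: "\<And>n. f n \<in> wshift_alg" "f \<longlonglongrightarrow> a"
    using assms unfolding closure_sequential by blast
  obtain g where g: "\<And>n. g n \<in> wshift_alg" "\<And>n. is_adjoint (f n) (g n)"
    using wshift_alg_adjoint[OF f(1)] by metis
  obtain b where b: "g \<longlonglongrightarrow> b" "is_adjoint a b"
    using adjoint_limit[OF g(2) f(2)] by blast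
  then have "b \<in> closure wshift_alg"
    using g(1) unfolding closure_sequential by blast
  with b(2) show "is_adjoint a (adjoint_of a)" "adjoint_of a \<in> closure wshift_alg"
    by (simp_all add: adjoint_of_eq)
qed

section \<open>The C*-algebra and its dense subalgebra\<close>

definition toeplitz :: "(ell2 \<Rightarrow>\<^sub>L ell2) cstar" where
  "toeplitz = \<lparr>c_carrier = closure wshift_alg, c_zero = 0, c_one = id_blinfun, c_add = (+),
     c_smult = (\<lambda>c a. cmult c o\<^sub>L a), c_mult = (o\<^sub>L), c_star = adjoint_of, c_norm = norm\<rparr>"

lemma toeplitz_simps [simp]:
  "c_carrier toeplitz = closure wshift_alg" "c_zero toeplitz = 0" "c_one toeplitz = id_blinfun"
  "c_add toeplitz = (+)" "c_smult toeplitz = (\<lambda>c a. cmult c o\<^sub>L a)" "c_mult toeplitz = (o\<^sub>L)"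
  "c_star toeplitz = adjoint_of" "c_norm toeplitz = norm"
  by (simp_all add: toeplitz_def)

lemma c_dist_toeplitz [simp]: "c_dist toeplitz a b = norm (a - b)"
proof -
  have "cmult (- 1) o\<^sub>L b = - b"
    by (rule blinfun_eqI) (simp add: cmult_minus_1 blinfun.minus_left)
  then show ?thesis by (simp add: c_dist_def)
qed

lemma toeplitz_complete:
  assumes "\<And>n. f n \<in> closure wshift_alg" "\<forall>e>0. \<exists>N. \<forall>m\<ge>N. \<forall>n\<ge>N. norm (f m - f n) < e"
  shows "\<exists>a\<in>closure wshift_alg. (\<lambda>n. norm (f n - a)) \<longlonglongrightarrow> 0"
proof -
  have "Cauchy f" using assms(2) by (simp add: Cauchy_iff)
  then obtain a where a: "f \<longlonglongrightarrow> a"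
    by (auto simp: Cauchy_convergent_iff convergent_def)
  then have "a \<in> closure wshift_alg"
    using closed_sequentially[OF closed_closure] assms(1) by blast
  with a show ?thesis by (auto simp: tendsto_norm_zero_iff LIM_zero_iff)
qed

lemma toeplitz_cstar: "unital_cstar_algebra toeplitz"
proof -
  note adj = closure_wshift_alg_adjoint(1)
  have neg: "\<exists>y\<in>closure wshift_alg. x + y = 0" if "x \<in> closure wshift_alg" for x
  proof
    show "x + (cmult (- 1) o\<^sub>L x) = 0"
      by (rule blinfun_eqI) (simp add: cmult_minus_1 blinfun.minus_left blinfun.add_left)
  qed (use that in \<open>intro closure_wshift_alg_compose closure_wshift_alg_generators\<close>)
  \<comment> \<open>Adjoints reverse composition, which leaves the conjugated scalar on the right;
    it has to be commuted back.\<close>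
  have star_smult: "adjoint_of (cmult c o\<^sub>L x) = cmult (cnj c) o\<^sub>L adjoint_of x" if "x \<in> closure wshift_alg" for c x
    using adjoint_of_eq[OF is_adjoint_compose[OF is_adjoint_cmult adj[OF that]]]
      closure_wshift_alg_cmult_commute[OF closure_wshift_alg_adjoint(2)[OF that]] by simp
  have smult_right: "x o\<^sub>L (cmult c o\<^sub>L y) = cmult c o\<^sub>L (x o\<^sub>L y)" if "x \<in> closure wshift_alg" for c x y
    using closure_wshift_alg_cmult_commute[OF that] by (simp add: compose_assoc[symmetric])
  show ?thesis
    unfolding unital_cstar_algebra_def Let_def toeplitz_simps c_dist_toeplitz
    by (intro conjI ballI allI impI; (rule add.assoc add.commute | rule smult_right[symmetric] star_smult, assumption | simp add: closure_wshift_alg_generators closure_wshift_alg_add closure_wshift_alg_compose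
        closure_wshift_alg_adjoint(2) neg toeplitz_complete
        compose_add_left compose_add_right compose_assoc cmult_1 cmult_add cmult_mult
        adjoint_of_eq[OF is_adjoint_sym[OF adj]] adjoint_of_eq[OF is_adjoint_add[OF adj adj]]
        adjoint_of_eq[OF is_adjoint_compose[OF adj adj]] norm_adjoint_compose[OF adj] norm_cmult_compose
        norm_triangle_ineq norm_blinfun_compose))
qed

text \<open>With e = 1 - T*T the Neumann series gives d with d T*T = 1. So d T* is a left inverse of
  the shift T, and T has no right inverse.\<close>

lemma toeplitz_infinite:
  "\<not> alg_finite (c_carrier toeplitz) (c_mult toeplitz) (c_one toeplitz)"
proof -
  let ?e = "id_blinfun - (wshift_adj o\<^sub>L wshift)"
  have "?e \<in> wshift_alg"
    by (intro wshift_alg_diff wshift_alg_compose wshift_alg.one wshift_alg_generators)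
  then obtain d where d: "d \<in> closure wshift_alg" "d o\<^sub>L (id_blinfun - ?e) = id_blinfun"
    using neumann_left_inverse[of ?e wshift_alg] norm_one_minus_wshift_adj_wshift
      wshift_alg.one wshift_alg.add wshift_alg_compose wshift_alg_zero by fastforce
  have "d o\<^sub>L wshift_adj \<in> closure wshift_alg"
    by (intro closure_wshift_alg_compose closure_wshift_alg_generators d)
  moreover have "(d o\<^sub>L wshift_adj) o\<^sub>L wshift = id_blinfun"
    using d(2) by (simp add: compose_assoc)
  ultimately show ?thesis
    using wshift_not_right_invertible closure_wshift_alg_generators(1) by (auto simp: alg_finite_def)
qed

lemma toeplitz_subalgebra: "unital_star_subalgebra toeplitz wshift_alg"
proof -
  have "adjoint_of a \<in> wshift_alg" if "a \<in> wshift_alg" for a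
    using wshift_alg_adjoint[OF that] adjoint_of_eq by blast
  then show ?thesis
    by (simp add: unital_star_subalgebra_def closure_subset wshift_alg_zero wshift_alg.one
        wshift_alg.add wshift_alg_compose wshift_alg.smult)
qed

lemma toeplitz_dense: "norm_dense toeplitz wshift_alg"
  unfolding norm_dense_def
proof (intro ballI allI impI)
  fix a and e :: real assume "a \<in> c_carrier toeplitz" "e > 0"
  then obtain b where "b \<in> wshift_alg" "dist b a < e"
    unfolding toeplitz_simps closure_approachable by blast
  then show "\<exists>b\<in>wshift_alg. c_dist toeplitz a b < e"
    by (auto simp: dist_norm norm_minus_commute)
qed

lemma asum_eq_sum: "asum (+) 0 f n = (\<Sum>k<n. f k)"
  by (induction n) auto

lemma toeplitz_stably_finite: "stably_finite toeplitz wshift_alg"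
  unfolding stably_finite_def alg_finite_def toeplitz_simps
proof (intro allI ballI impI ext)
  fix n X Y i j
  assume X: "X \<in> mats n wshift_alg" and Y: "Y \<in> mats n wshift_alg"
    and XY: "mat_mult (+) 0 (o\<^sub>L) n X Y = mat_one 0 id_blinfun n"
  have "(\<Sum>k<n. X i k o\<^sub>L Y k j) = (if i = j then id_blinfun else 0)" if "i < n" "j < n" for i j
    using fun_cong[OF fun_cong[OF XY], of i j] that by (simp add: mat_mult_def mat_one_def asum_eq_sum)
  from wshift_alg_stably_finite[of n X Y i j, OF _ _ this]
  show "mat_mult (+) 0 (o\<^sub>L) n Y X i j = mat_one 0 id_blinfun n i j"
    using X Y by (auto simp: mat_mult_def mat_one_def asum_eq_sum mats_def)
qed

subsection \<open>Transport along an injection\<close>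

text \<open>Moves the algebra from operators on the newly defined type \<open>ell2\<close> to a
  carrier built from standard types. The operations pull their arguments back by
  \<open>the_inv \<phi>\<close> and are meant for arguments in the range of
  \<open>\<phi>\<close>.\<close>

definition map_cstar :: "('a \<Rightarrow> 'b) \<Rightarrow> 'a cstar \<Rightarrow> 'b cstar" where
  "map_cstar \<phi> A = \<lparr>c_carrier = \<phi> ` c_carrier A, c_zero = \<phi> (c_zero A), c_one = \<phi> (c_one A),
     c_add = (\<lambda>x y. \<phi> (c_add A (the_inv \<phi> x) (the_inv \<phi> y))),
     c_smult = (\<lambda>c x. \<phi> (c_smult A c (the_inv \<phi> x))),
     c_mult = (\<lambda>x y. \<phi> (c_mult A (the_inv \<phi> x) (the_inv \<phi> y))),
     c_star = (\<lambda>x. \<phi> (c_star A (the_inv \<phi> x))), c_norm = (\<lambda>x. c_norm A (the_inv \<phi> x))\<rparr>"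

lemma map_cstar_simps [simp]:
  assumes "inj \<phi>"
  shows "c_carrier (map_cstar \<phi> A) = \<phi> ` c_carrier A" "c_zero (map_cstar \<phi> A) = \<phi> (c_zero A)"
    "c_one (map_cstar \<phi> A) = \<phi> (c_one A)"
    "c_add (map_cstar \<phi> A) (\<phi> x) (\<phi> y) = \<phi> (c_add A x y)"
    "c_smult (map_cstar \<phi> A) c (\<phi> x) = \<phi> (c_smult A c x)"
    "c_mult (map_cstar \<phi> A) (\<phi> x) (\<phi> y) = \<phi> (c_mult A x y)"
    "c_star (map_cstar \<phi> A) (\<phi> x) = \<phi> (c_star A x)"
    "c_norm (map_cstar \<phi> A) (\<phi> x) = c_norm A x"
    "c_dist (map_cstar \<phi> A) (\<phi> x) (\<phi> y) = c_dist A x y"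
  using assms by (simp_all add: map_cstar_def c_dist_def the_inv_f_f)

lemma map_cstar_unital_cstar_algebra:
  assumes \<phi>: "inj \<phi>" and A: "unital_cstar_algebra A"
  shows "unital_cstar_algebra (map_cstar \<phi> A)"
proof -
  \<comment> \<open>Completeness quantifies over sequences, so a sequence in the image has to be
    pulled back explicitly; the other axioms transfer by rewriting.\<close>
  have complete: "\<exists>x\<in>c_carrier A. (\<lambda>n. c_dist (map_cstar \<phi> A) (f n) (\<phi> x)) \<longlonglongrightarrow> 0"
    if f: "\<forall>n. f n \<in> \<phi> ` c_carrier A"
      and Cauchy: "\<forall>e>0. \<exists>N. \<forall>m\<ge>N. \<forall>n\<ge>N. c_dist (map_cstar \<phi> A) (f m) (f n) < e" for f
  proof -
    have "\<forall>n. \<exists>x. x \<in> c_carrier A \<and> f n = \<phi> x" using f by blast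
    then obtain g where g: "\<And>n. g n \<in> c_carrier A" and fg: "f = (\<lambda>n. \<phi> (g n))" by metis
    have "\<forall>f. (\<forall>n. f n \<in> c_carrier A) \<longrightarrow>
        (\<forall>e>0. \<exists>N. \<forall>m\<ge>N. \<forall>n\<ge>N. c_dist A (f m) (f n) < e) \<longrightarrow>
        (\<exists>x\<in>c_carrier A. (\<lambda>n. c_dist A (f n) x) \<longlonglongrightarrow> 0)"
      using A unfolding unital_cstar_algebra_def Let_def by (elim conjE)
    from this[rule_format, of g] show ?thesis
      using g Cauchy unfolding fg map_cstar_simps[OF \<phi>] by blast
  qed
  show ?thesis
    using A unfolding unital_cstar_algebra_def Let_def
    by (elim conjE, intro conjI)
      (simp_all add: \<phi> inj_image_mem_iff inj_eq complete)
qed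

lemma map_cstar_alg_finite:
  assumes "inj \<phi>"
  shows "alg_finite (c_carrier (map_cstar \<phi> A)) (c_mult (map_cstar \<phi> A)) (c_one (map_cstar \<phi> A)) \<longleftrightarrow>
    alg_finite (c_carrier A) (c_mult A) (c_one A)"
  by (simp add: alg_finite_def assms inj_eq)

lemma map_cstar_subalgebra:
  assumes "inj \<phi>" "unital_star_subalgebra A S"
  shows "unital_star_subalgebra (map_cstar \<phi> A) (\<phi> ` S)"
  using assms(2) by (simp add: unital_star_subalgebra_def assms(1) inj_image_mem_iff inj_image_subset_iff)

lemma map_cstar_dense:
  assumes "inj \<phi>" "norm_dense A S"
  shows "norm_dense (map_cstar \<phi> A) (\<phi> ` S)"
  using assms(2) by (simp add: norm_dense_def assms(1))

lemma asum_map_cstar: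
  assumes "inj \<phi>"
  shows "asum (c_add (map_cstar \<phi> A)) (\<phi> (c_zero A)) (\<lambda>k. \<phi> (f k)) n = \<phi> (asum (c_add A) (c_zero A) f n)"
  by (induction n) (simp_all add: assms)

lemma asum_cong: "(\<And>k. k < n \<Longrightarrow> f k = g k) \<Longrightarrow> asum pl z f n = asum pl z g n"
  by (induction n) auto

lemma map_cstar_stably_finite:
  assumes \<phi>: "inj \<phi>" and A: "stably_finite A S"
  shows "stably_finite (map_cstar \<phi> A) (\<phi> ` S)"
  unfolding stably_finite_def alg_finite_def
proof (intro allI ballI impI)
  fix n :: nat and X Y
  assume "1 \<le> n" and X: "X \<in> mats n (\<phi> ` S)" and Y: "Y \<in> mats n (\<phi> ` S)"
    and XY: "mat_mult (c_add (map_cstar \<phi> A)) (c_zero (map_cstar \<phi> A)) (c_mult (map_cstar \<phi> A)) n X Y =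
      mat_one (c_zero (map_cstar \<phi> A)) (c_one (map_cstar \<phi> A)) n"
  \<comment> \<open>Entrywise pullback of a matrix. Outside the n by n block the value must be
    \<open>undefined\<close>, as \<open>mats\<close> prescribes.\<close>
  define \<psi> where "\<psi> Z = (\<lambda>i j. if i < n \<and> j < n then the_inv \<phi> (Z i j) else undefined)" for Z :: "nat \<Rightarrow> nat \<Rightarrow> 'b"
  have \<psi>: "\<psi> Z \<in> mats n S" "i < n \<Longrightarrow> j < n \<Longrightarrow> Z i j = \<phi> (\<psi> Z i j)" if "Z \<in> mats n (\<phi> ` S)" for Z i j
    using that by (auto simp: mats_def \<psi>_def \<phi> the_inv_f_f image_iff) (metis \<phi> the_inv_f_f)+
  have mult: "mat_mult (c_add (map_cstar \<phi> A)) (c_zero (map_cstar \<phi> A)) (c_mult (map_cstar \<phi> A)) n Z W i j =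
      \<phi> (mat_mult (c_add A) (c_zero A) (c_mult A) n (\<psi> Z) (\<psi> W) i j)"
    if "Z \<in> mats n (\<phi> ` S)" "W \<in> mats n (\<phi> ` S)" "i < n" "j < n" for Z W i j
  proof -
    have "asum (c_add (map_cstar \<phi> A)) (c_zero (map_cstar \<phi> A)) (\<lambda>k. c_mult (map_cstar \<phi> A) (Z i k) (W k j)) n =
        asum (c_add (map_cstar \<phi> A)) (c_zero (map_cstar \<phi> A)) (\<lambda>k. \<phi> (c_mult A (\<psi> Z i k) (\<psi> W k j))) n"
      by (rule asum_cong) (metis \<psi>(2) that map_cstar_simps(6)[OF \<phi>])
    then show ?thesis
      using that by (simp add: mat_mult_def asum_map_cstar[OF \<phi>] \<phi>)
  qed
  have "mat_mult (c_add A) (c_zero A) (c_mult A) n (\<psi> X) (\<psi> Y) = mat_one (c_zero A) (c_one A) n"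
  proof (intro ext)
    fix i j
    show "mat_mult (c_add A) (c_zero A) (c_mult A) n (\<psi> X) (\<psi> Y) i j = mat_one (c_zero A) (c_one A) n i j"
    proof (cases "i < n \<and> j < n")
      case True
      then have "\<phi> (mat_mult (c_add A) (c_zero A) (c_mult A) n (\<psi> X) (\<psi> Y) i j) = \<phi> (mat_one (c_zero A) (c_one A) n i j)"
        using fun_cong[OF fun_cong[OF XY], of i j] mult[OF X Y, of i j] by (auto simp: mat_one_def \<phi> split: if_splits)
      then show ?thesis using \<phi> by (simp add: inj_eq)
    qed (auto simp: mat_mult_def mat_one_def)
  qed
  then have YX: "mat_mult (c_add A) (c_zero A) (c_mult A) n (\<psi> Y) (\<psi> X) = mat_one (c_zero A) (c_one A) n"
    using A \<psi>(1)[OF X] \<psi>(1)[OF Y] \<open>1 \<le> n\<close> unfolding stably_finite_def alg_finite_def by blast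
  show "mat_mult (c_add (map_cstar \<phi> A)) (c_zero (map_cstar \<phi> A)) (c_mult (map_cstar \<phi> A)) n Y X =
      mat_one (c_zero (map_cstar \<phi> A)) (c_one (map_cstar \<phi> A)) n"
  proof (intro ext)
    fix i j
    show "mat_mult (c_add (map_cstar \<phi> A)) (c_zero (map_cstar \<phi> A)) (c_mult (map_cstar \<phi> A)) n Y X i j =
      mat_one (c_zero (map_cstar \<phi> A)) (c_one (map_cstar \<phi> A)) n i j"
    proof (cases "i < n \<and> j < n")
      case True
      then show ?thesis
        using mult[OF Y X, of i j] by (simp add: YX mat_one_def \<phi>)
    qed (auto simp: mat_mult_def mat_one_def)
  qed
qed

section \<open>Coding operators as sets of sequences\<close>

text \<open>An operator is encoded by its graph, each pair
  \<open>(x, a x)\<close> being interleaved into one sequence.\<close>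

definition graph_code :: "(ell2 \<Rightarrow>\<^sub>L ell2) \<Rightarrow> (nat \<Rightarrow> complex) set" where
  "graph_code a = range (\<lambda>x n. if even n then coord x (n div 2) else coord (a x) (n div 2))"

lemma inj_graph_code: "inj graph_code"
proof (rule injI, rule blinfun_eqI)
  fix a b x assume "graph_code a = graph_code b"
  then obtain y where y: "(\<lambda>n. if even n then coord x (n div 2) else coord (a x) (n div 2)) =
      (\<lambda>n. if even n then coord y (n div 2) else coord (b y) (n div 2))"
    unfolding graph_code_def by blast
  \<comment> \<open>The even positions identify the arguments of the common graph point, the odd
    positions then the values.\<close>
  have "x = y"
    by (rule ell2_eqI) (use fun_cong[OF y, of "2 * _"] in simp)
  moreover have "a x = b y"
    by (rule ell2_eqI) (use fun_cong[OF y, of "2 * _ + 1"] in simp)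
  ultimately show "a x = b x" by simp
qed

theorem theorem1p1:
  shows "\<exists>(A :: (nat \<Rightarrow> complex) set cstar) A0.
           unital_cstar_algebra A \<and>
           \<not> alg_finite (c_carrier A) (c_mult A) (c_one A) \<and>
           unital_star_subalgebra A A0 \<and> norm_dense A A0 \<and>
           stably_finite A A0"
proof (intro exI conjI)
  note inj = inj_graph_code
  show "unital_cstar_algebra (map_cstar graph_code toeplitz)"
    by (rule map_cstar_unital_cstar_algebra[OF inj toeplitz_cstar])
  show "\<not> alg_finite (c_carrier (map_cstar graph_code toeplitz)) (c_mult (map_cstar graph_code toeplitz))
      (c_one (map_cstar graph_code toeplitz))"
    unfolding map_cstar_alg_finite[OF inj] by (rule toeplitz_infinite)
  show "unital_star_subalgebra (map_cstar graph_code toeplitz) (graph_code ` wshift_alg)"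
    by (rule map_cstar_subalgebra[OF inj toeplitz_subalgebra])
  show "norm_dense (map_cstar graph_code toeplitz) (graph_code ` wshift_alg)"
    by (rule map_cstar_dense[OF inj toeplitz_dense])
  show "stably_finite (map_cstar graph_code toeplitz) (graph_code ` wshift_alg)"
    by (rule map_cstar_stably_finite[OF inj toeplitz_stably_finite])
qed

end
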